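(* Let $n\ge1$, $k\ge1$, let $\mathbf C_n\subset SU_2$ be the cyclic group of order $n$ acting on $V=\mathbb C^2$, $Z_k(\mathbf C_n)=\mathrm{End}_{\mathbf C_n}(V^{\otimes k})$, and $\tilde n=n$ if $n$ is odd, $\tilde n=n/2$ if $n$ is even. Suppose $\ell\in\Lambda_k(\mathbf C_n)$ and let $a_\ell\in\{0,1,\dots,k\}$ be minimal with $k-2a_\ell\equiv\ell\bmod n$. Then $Z_k^{(\ell)}=\mathrm{span}_{\mathbb C}\{v_{\mathsf r}\in V^{\otimes k}\mid|\mathsf r|\equiv a_\ell\bmod\tilde n\}$ is an irreducible $Z_k(\mathbf C_n)$-module and the following hold: (i) $\dim Z_k^{(\ell)}=\displaystyle\sum_{\substack{0\le b\le k\\ b\equiv a_\ell\bmod\tilde n}}\binom kb$, which is the coefficient of $z^{a_\ell}$ in $(1+z)^k\big|_{z^{\tilde n}=1}$. (ii) As a bimodule for $\mathbf C_n\times Z_k(\mathbf C_n)$, $V^{\otimes k}\cong\bigoplus_{\ell\in\Lambda_k(\mathbf C_n)}\big(\mathbf C_n^{(\ell)}\otimes Z_k^{(\ell)}\big)$, where $\mathbf C_n$ acts only on the factors $\mathbf C_n^{(\ell)}$ and $Z_k(\mathbf C_n)$ only on the factors $Z_k^{(\ell)}$. (Since $Z_k^{(\ell)}$ is also both a $\mathbf C_n$- and a $Z_k(\mathbf C_n)$-module and the actions commute, the decomposition $V^{\otimes k}=\bigoplus_{\ell\in\Lambda_k(\mathbf C_n)}Z_k^{(\ell)}$ is also a $\mathbf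 C_n\times Z_k(\mathbf C_n)$-bimodule decomposition.) (iii) $\mathbf C_n^{(\ell)}$ occurs as a summand in the $\mathbf C_n$-module $V^{\otimes k}$ with multiplicity $m_k^{(\ell)}=\displaystyle\sum_{\substack{0\le b\le k\\ b\equiv a_\ell\bmod\tilde n}}\binom kb=\dim Z_k^{(\ell)}$. (iv) The number of walks on the affine Dynkin diagram of type $\hat{\mathsf A}_{n-1}$ starting at node $0$ and ending at node $\ell$ and taking $k$ steps is the coefficient of $z^{a_\ell}$ in $(1+z)^k\big|_{z^{\tilde n}=1}$, which is $m_k^{(\ell)}=\dim Z_k^{(\ell)}$.
   Context: $\mathbf C_n$ is the subgroup of $SU_2$ generated by $g=\mathrm{diag}(\zeta^{-1},\zeta)$, $\zeta$ a primitive $n$th root of unity. $V=\mathbb C^2$ has basis $v_{-1}=(1,0)^t$, $v_1=(0,1)^t$, and $\mathbf C_n$ acts diagonally on $V^{\otimes k}$. For $\mathsf r\in\{-1,1\}^k$: $v_{\mathsf r}=v_{r_1}\otimes\cdots\otimes v_{r_k}$ and $|\mathsf r|$ is the number of $i$ with $r_i=-1$. $\mathbf C_n^{(\ell)}$, $\ell\in\{0,\dots,n-1\}$, is the one-dimensional module on which $g$ acts by $\zeta^\ell$, and $\Lambda_k(\mathbf C_n)=\{\ell\in\{0,\dots,n-1\}\mid\ell\equiv k-2a\bmod n\text{ for some }a\in\{0,\dots,k\}\}$. The notation $(1+z)^k|_{z^{\tilde n}=1}$ means the image of $(1+z)^k$ in $\mathbb C[z]/(z^{\tilde n}-1)$,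 exponents being read modulo $\tilde n$. The affine Dynkin diagram of type $\hat{\mathsf A}_{n-1}$ is the circular graph with nodes $0,\dots,n-1$; each step of a walk goes from $j$ to $j\pm1$ modulo $n$, and walks are counted as sequences of $\pm1$ steps (for $n\ge3$ this is the usual notion of walk). *)

theory Defs
  imports
    "HOL-Analysis.Analysis"
    "HOL-Algebra.Generated_Groups"
    "HOL-Computational_Algebra.Polynomial"
    "HOL-Number_Theory.Cong"
begin

section \<open>The cyclic subgroup of the special unitary group\<close>

definition SU2 :: "(complex^2^2) monoid" where
  "SU2 = \<lparr>carrier = {A. A ** map_matrix cnj (transpose A) = mat 1 \<and> det A = 1},
          mult = (**), one = mat 1\<rparr>"

definition primitive_root_of_unity :: "nat \<Rightarrow> complex \<Rightarrow> bool" where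
  "primitive_root_of_unity n \<zeta> \<longleftrightarrow> \<zeta> ^ n = 1 \<and> (\<forall>m. 0 < m \<and> m < n \<longrightarrow> \<zeta> ^ m \<noteq> 1)"

definition cyc_gen :: "complex \<Rightarrow> complex^2^2" where
  "cyc_gen \<zeta> = vector [vector [inverse \<zeta>, 0], vector [0, \<zeta>]]"

definition cyc_group :: "complex \<Rightarrow> (complex^2^2) set" where
  "cyc_group \<zeta> = generate SU2 {cyc_gen \<zeta>}"

lemma group_SU2: "group SU2"
proof (rule groupI)
  show "x \<otimes>\<^bsub>SU2\<^esub> y \<in> carrier SU2"
    if x: "x \<in> carrier SU2" and y: "y \<in> carrier SU2" for x y
  proof -
    have 1: "x ** map_matrix cnj (transpose x) = mat 1" "y ** map_matrix cnj (transpose y) = mat 1"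
      using x y by (auto simp: SU2_def)
    have "map_matrix cnj (transpose (x ** y))
        = map_matrix cnj (transpose y) ** map_matrix cnj (transpose x)"
      by (simp add: vec_eq_iff matrix_matrix_mult_def transpose_def mult.commute)
    then have "(x ** y) ** map_matrix cnj (transpose (x ** y))
        = x ** (y ** map_matrix cnj (transpose y)) ** map_matrix cnj (transpose x)"
      by (simp add: matrix_mul_assoc)
    also have "\<dots> = mat 1"
      using 1 by simp
    finally show ?thesis
      using x y by (simp add: SU2_def det_mul)
  qed
next
  show "\<one>\<^bsub>SU2\<^esub> \<in> carrier SU2"
    by (simp add: SU2_def transpose_mat)
       (simp add: vec_eq_iff mat_def matrix_matrix_mult_def sum_2 forall_2)
next
  show "\<exists>y\<in>carrier SU2. y \<otimes>\<^bsub>SU2\<^esub> x = \<one>\<^bsub>SU2\<^esub>" if x: "x \<in> carrier SU2" for x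
  proof (rule bexI[of _ "map_matrix cnj (transpose x)"])
    have 1: "x ** map_matrix cnj (transpose x) = mat 1" and 2: "det x = 1"
      using x by (auto simp: SU2_def)
    from 1 show 3: "map_matrix cnj (transpose x) \<otimes>\<^bsub>SU2\<^esub> x = \<one>\<^bsub>SU2\<^esub>"
      by (simp add: SU2_def matrix_left_right_inverse)
    have 4: "map_matrix cnj (transpose (map_matrix cnj (transpose x))) = x"
      by (simp add: vec_eq_iff transpose_def)
    have "det (map_matrix cnj (transpose x)) = 1"
      using 1 2 by (metis det_I det_mul mult_1)
    then show "map_matrix cnj (transpose x) \<in> carrier SU2"
      using 3 4 by (simp add: SU2_def)
  qed
qed (auto simp: SU2_def matrix_mul_assoc)

lemma cyc_gen_in_SU2:
  assumes "primitive_root_of_unity n \<zeta>" and "n \<ge> 1"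
  shows "cyc_gen \<zeta> \<in> carrier SU2"
proof -
  have n: "\<zeta> ^ n = 1"
    using assms by (simp add: primitive_root_of_unity_def)
  have "norm \<zeta> = 1"
    using n assms(2) by (metis norm_one norm_power norm_ge_zero power_eq_1_iff not_one_le_zero)
  then have "\<zeta> * cnj \<zeta> = 1" and "\<zeta> \<noteq> 0"
    by (auto simp: complex_norm_square[symmetric])
  then show ?thesis
    by (simp add: SU2_def cyc_gen_def vec_eq_iff forall_2 matrix_matrix_mult_def sum_2
        transpose_def mat_def det_2 field_simps)
qed


section \<open>Tensor products in coordinates\<close>

text \<open>
  The \<open>k\<close>-th tensor power of \<open>V = \<complex>\<^sup>2\<close> is the coordinate space \<open>complex ^ ('k \<Rightarrow> 2)\<close>,
  where the finite type \<open>'k\<close> indexes the tensor positions and \<open>k = CARD('k)\<close>. The coordinate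
  at \<open>s\<close> belongs to the tensor product of the standard basis vectors \<open>axis (s i) 1\<close>.
  The tensor product of \<open>\<complex>\<^sup>a\<close> and \<open>\<complex>\<^sup>b\<close> is likewise \<open>complex ^ ('a \<times> 'b)\<close>.
\<close>

definition tensor_vecs :: "('k::finite \<Rightarrow> complex^2) \<Rightarrow> complex^('k \<Rightarrow> 2)" where
  "tensor_vecs w = (\<chi> s. \<Prod>i\<in>UNIV. w i $ s i)"

definition diag_action :: "complex^2^2 \<Rightarrow> complex^('k::finite \<Rightarrow> 2) \<Rightarrow> complex^('k \<Rightarrow> 2)" where
  "diag_action h x = (\<chi> s t. \<Prod>i\<in>UNIV. h $ s i $ t i) *v x"

text \<open>The matrix in \<open>diag_action\<close> is the Kronecker power of \<open>h\<close>.\<close>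

lemma diag_action_tensor_vecs:
  "diag_action h (tensor_vecs w) = tensor_vecs (\<lambda>i. h *v w i)"
proof -
  have "(\<Sum>t\<in>UNIV. (\<Prod>i\<in>UNIV. h $ s i $ t i) * (\<Prod>i\<in>UNIV. w i $ t i))
      = (\<Prod>i\<in>UNIV. \<Sum>j\<in>UNIV. h $ s i $ j * w i $ j)" for s :: "'a \<Rightarrow> 2"
    by (subst prod_sum_PiE) (simp_all add: prod.distrib PiE_UNIV_domain)
  then show ?thesis
    by (simp add: diag_action_def tensor_vecs_def matrix_vector_mult_def vec_eq_iff)
qed

definition tensor2 :: "complex^'a::finite \<Rightarrow> complex^'b::finite \<Rightarrow> complex^('a \<times> 'b)" where
  "tensor2 u w = (\<chi> p. u $ fst p * w $ snd p)"

definition tensor_space ::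
    "(complex^'a::finite) set \<Rightarrow> (complex^'b::finite) set \<Rightarrow> (complex^('a \<times> 'b)) set" where
  "tensor_space U W = vec.span {tensor2 u w | u w. u \<in> U \<and> w \<in> W}"

definition tensor_map ::
    "(complex^'a::finite \<Rightarrow> complex^'a) \<Rightarrow> (complex^'b::finite \<Rightarrow> complex^'b)
      \<Rightarrow> complex^('a \<times> 'b) \<Rightarrow> complex^('a \<times> 'b)" where
  "tensor_map S T x =
     (\<Sum>q\<in>UNIV. x $ q *s tensor2 (S (axis (fst q) 1)) (T (axis (snd q) 1)))"

lemma tensor_map_tensor2:
  assumes S: "Vector_Spaces.linear (*s) (*s) S" and T: "Vector_Spaces.linear (*s) (*s) T"
  shows "tensor_map S T (tensor2 u w) = tensor2 (S u) (T w)"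
proof -
  interpret S: Vector_Spaces.linear "(*s)" "(*s)" S by fact
  interpret T: Vector_Spaces.linear "(*s)" "(*s)" T by fact
  have "S u = (\<Sum>i\<in>UNIV. u $ i *s S (axis i 1))"
    by (subst (1) basis_expansion[symmetric, of u]) (simp only: S.sum S.scale)
  moreover have "T w = (\<Sum>j\<in>UNIV. w $ j *s T (axis j 1))"
    by (subst (1) basis_expansion[symmetric, of w]) (simp only: T.sum T.scale)
  ultimately show ?thesis
    by (simp add: tensor_map_def tensor2_def vec_eq_iff sum_product sum.cartesian_product
        split_def mult_ac)
qed


section \<open>Modules\<close>

text \<open>
  Modules are linear subspaces of a coordinate space together with a set of operators (the
  action of an algebra or of a group) on the ambient space which preserve the subspace.
\<close>

definition is_submodule :: "(complex^'a \<Rightarrow> complex^'a) set \<Rightarrow> (complex^'a::finite) set \<Rightarrow> bool" where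
  "is_submodule A W \<longleftrightarrow> vec.subspace W \<and> (\<forall>T\<in>A. \<forall>x\<in>W. T x \<in> W)"

definition irreducible_module :: "(complex^'a \<Rightarrow> complex^'a) set \<Rightarrow> (complex^'a::finite) set \<Rightarrow> bool" where
  "irreducible_module A W \<longleftrightarrow> is_submodule A W \<and> W \<noteq> {0} \<and>
     (\<forall>U. is_submodule A U \<and> U \<subseteq> W \<longrightarrow> U = {0} \<or> U = W)"

definition End_group ::
    "'g set \<Rightarrow> ('g \<Rightarrow> complex^'a \<Rightarrow> complex^'a) \<Rightarrow> (complex^'a::finite \<Rightarrow> complex^'a) set" where
  "End_group G \<rho> = {T. Vector_Spaces.linear (*s) (*s) T \<and> (\<forall>h\<in>G. \<forall>x. T (\<rho> h x) = \<rho> h (T x))}"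

definition module_iso ::
    "'g set \<Rightarrow> ('g \<Rightarrow> complex^'a \<Rightarrow> complex^'a) \<Rightarrow> (complex^'a::finite) set
      \<Rightarrow> ('g \<Rightarrow> complex^'b \<Rightarrow> complex^'b) \<Rightarrow> (complex^'b::finite) set \<Rightarrow> bool" where
  "module_iso G \<rho> W \<sigma> U \<longleftrightarrow> (\<exists>\<phi>. bij_betw \<phi> W U \<and>
     (\<forall>x\<in>W. \<forall>y\<in>W. \<phi> (x + y) = \<phi> x + \<phi> y) \<and>
     (\<forall>c. \<forall>x\<in>W. \<phi> (c *s x) = c *s \<phi> x) \<and>
     (\<forall>h\<in>G. \<forall>x\<in>W. \<phi> (\<rho> h x) = \<sigma> h (\<phi> x)))"

text \<open>
  The external direct sum of a family \<open>M\<close> over a finite index set \<open>I\<close> is \<open>Pi\<^sub>E I M\<close> with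
  componentwise operations.
\<close>

definition internal_direct_sum ::
    "'i set \<Rightarrow> ('i \<Rightarrow> (complex^'a::finite) set) \<Rightarrow> (complex^'a) set \<Rightarrow> bool" where
  "internal_direct_sum I M W \<longleftrightarrow> finite I \<and> (\<forall>i\<in>I. vec.subspace (M i)) \<and>
     bij_betw (\<lambda>w. \<Sum>i\<in>I. w i) (Pi\<^sub>E I M) W"

definition linear_iso_to_direct_sum ::
    "(complex^'a::finite \<Rightarrow> 'i \<Rightarrow> complex^'b::finite) \<Rightarrow> (complex^'a) set
      \<Rightarrow> 'i set \<Rightarrow> ('i \<Rightarrow> (complex^'b) set) \<Rightarrow> bool" where
  "linear_iso_to_direct_sum \<Phi> W I M \<longleftrightarrow>
     finite I \<and> (\<forall>i\<in>I. vec.subspace (M i)) \<and> bij_betw \<Phi> W (Pi\<^sub>E I M) \<and>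
     (\<forall>x\<in>W. \<forall>y\<in>W. \<forall>i\<in>I. \<Phi> (x + y) i = \<Phi> x i + \<Phi> y i) \<and>
     (\<forall>c. \<forall>x\<in>W. \<forall>i\<in>I. \<Phi> (c *s x) i = c *s \<Phi> x i)"

definition irreducible_decomposition ::
    "'g set \<Rightarrow> ('g \<Rightarrow> complex^'a \<Rightarrow> complex^'a) \<Rightarrow> (complex^'a::finite) set
      \<Rightarrow> (complex^'a) set set \<Rightarrow> bool" where
  "irreducible_decomposition G \<rho> W D \<longleftrightarrow>
     (\<forall>U\<in>D. irreducible_module (\<rho> ` G) U) \<and> internal_direct_sum D (\<lambda>U. U) W"

text \<open>
  The multiplicity of \<open>(\<sigma>, U)\<close> in \<open>(\<rho>, W)\<close> counts the summands isomorphic to \<open>U\<close> in a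
  decomposition of \<open>W\<close> into irreducible modules; existence of a decomposition and independence
  of its choice are required.
\<close>

definition has_multiplicity ::
    "'g set \<Rightarrow> ('g \<Rightarrow> complex^'a \<Rightarrow> complex^'a) \<Rightarrow> (complex^'a::finite) set
      \<Rightarrow> ('g \<Rightarrow> complex^'b \<Rightarrow> complex^'b) \<Rightarrow> (complex^'b::finite) set \<Rightarrow> nat \<Rightarrow> bool" where
  "has_multiplicity G \<rho> W \<sigma> U m \<longleftrightarrow>
     (\<exists>D. irreducible_decomposition G \<rho> W D) \<and>
     (\<forall>D. irreducible_decomposition G \<rho> W D \<longrightarrow> card {X\<in>D. module_iso G \<rho> X \<sigma> U} = m)"


section \<open>The modules of the cyclic group and of its centralizer algebra\<close>

text \<open>
  The one-dimensional module on which \<open>cyc_gen \<zeta>\<close> acts by \<open>\<zeta> ^ l\<close> has underlying space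
  \<open>complex ^ 1\<close>: the lower right entry of \<open>cyc_gen \<zeta> ^ j\<close> is \<open>\<zeta> ^ j\<close>.
\<close>

definition char_action :: "nat \<Rightarrow> complex^2^2 \<Rightarrow> complex^1 \<Rightarrow> complex^1" where
  "char_action l h x = (h $ 2 $ 2) ^ l *s x"

lemma char_action_cyc_gen: "char_action l (cyc_gen \<zeta>) x = \<zeta> ^ l *s x"
  by (simp add: char_action_def cyc_gen_def)

lemma cyc_group_diagonal:
  assumes "primitive_root_of_unity n \<zeta>" and "n \<ge> 1" and "h \<in> cyc_group \<zeta>"
  shows "h $ 1 $ 2 = 0 \<and> h $ 2 $ 1 = 0"
  using assms(3) unfolding cyc_group_def
proof (induction rule: generate.induct)
  case one
  show ?case by (simp add: SU2_def mat_def)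
next
  case (incl h)
  then show ?case by (simp add: cyc_gen_def)
next
  case (inv h)
  interpret group SU2 by (rule group_SU2)
  have h: "h \<in> carrier SU2" "h = cyc_gen \<zeta>"
    using inv cyc_gen_in_SU2[OF assms(1,2)] by auto
  have z: "\<zeta> \<noteq> 0"
    using assms(1,2) by (auto simp: primitive_root_of_unity_def zero_power)
  have "inv\<^bsub>SU2\<^esub> h ** h = mat 1"
    using l_inv[OF h(1)] by (simp add: SU2_def)
  then show ?case
    using z unfolding h(2)
    by (simp add: cyc_gen_def vec_eq_iff forall_2 matrix_matrix_mult_def sum_2 mat_def)
next
  case (eng h1 h2)
  then show ?case by (simp add: SU2_def matrix_matrix_mult_def sum_2)
qed

lemma char_action_mult:
  assumes "primitive_root_of_unity n \<zeta>" and "n \<ge> 1"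
    and "h1 \<in> cyc_group \<zeta>" and "h2 \<in> cyc_group \<zeta>"
  shows "char_action l (h1 ** h2) x = char_action l h1 (char_action l h2 x)"
  using cyc_group_diagonal[OF assms(1-3)]
  by (simp add: char_action_def matrix_matrix_mult_def sum_2 power_mult_distrib)

definition vbasis :: "int \<Rightarrow> complex^2" where
  "vbasis r = (if r = -1 then vector [1, 0] else vector [0, 1])"

definition sign_seqs :: "('k::finite \<Rightarrow> int) set" where
  "sign_seqs = {r. \<forall>i. r i \<in> {-1, 1}}"

definition neg_count :: "('k::finite \<Rightarrow> int) \<Rightarrow> nat" where
  "neg_count r = card {i. r i = -1}"

definition Lambda :: "nat \<Rightarrow> nat \<Rightarrow> nat set" where
  "Lambda n k = {l. l < n \<and> (\<exists>a\<le>k. [int l = int k - 2 * int a] (mod int n))}"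

definition n_tilde :: "nat \<Rightarrow> nat" where
  "n_tilde n = (if odd n then n else n div 2)"

definition a_min :: "nat \<Rightarrow> nat \<Rightarrow> nat \<Rightarrow> nat" where
  "a_min n k l = (LEAST a. a \<le> k \<and> [int k - 2 * int a = int l] (mod int n))"

definition Zmod :: "nat \<Rightarrow> nat \<Rightarrow> (complex^('k::finite \<Rightarrow> 2)) set" where
  "Zmod n l = vec.span {tensor_vecs (\<lambda>i. vbasis (r i)) | r.
     r \<in> sign_seqs \<and> [neg_count r = a_min n CARD('k) l] (mod n_tilde n)}"


section \<open>Coefficients modulo \<open>z ^ m = 1\<close> and walks\<close>

text \<open>
  The class of \<open>p\<close> in \<open>\<complex>[z]/(z\<^sup>m - 1)\<close> is represented by its unique member of degree less
  than \<open>m\<close>.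
\<close>

definition cyclic_coeff :: "nat \<Rightarrow> complex poly \<Rightarrow> nat \<Rightarrow> complex" where
  "cyclic_coeff m p a = poly.coeff (p mod (monom 1 m - 1)) (a mod m)"

text \<open>
  Walks on the circular graph with nodes \<open>0, \<dots>, n - 1\<close>, given by their steps: for \<open>n \<le> 2\<close>
  the steps \<open>1\<close> and \<open>-1\<close> lead to the same node but are counted separately.
\<close>

definition walks :: "nat \<Rightarrow> nat \<Rightarrow> nat \<Rightarrow> nat \<Rightarrow> int list set" where
  "walks n i j k = {s. length s = k \<and> set s \<subseteq> {-1, 1} \<and>
     foldl (\<lambda>v d. (v + d) mod int n) (int i) s = int j}"

end

theory Submission
  imports Defs
begin

text \<open>
  Everything is read off the basis tensors. The generator \<open>g\<close> is diagonal, so it multiplies the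
  basis tensor with sign sequence \<open>r\<close> by \<open>\<zeta>\<close> to the power \<open>k - 2 \<bar>r\<bar>\<close>. Call the residue of this
  exponent modulo \<open>n\<close> its weight. The weights that occur are exactly the elements of \<open>Lambda n k\<close>,
  and weight \<open>l\<close> means \<open>\<bar>r\<bar> \<equiv> a_min n k l\<close> modulo \<open>n_tilde n\<close>, since \<open>2 a \<equiv> 2 b\<close> modulo \<open>n\<close> iff
  \<open>a \<equiv> b\<close> modulo \<open>n_tilde n\<close> (\<open>weight_eq_iff_ones\<close>). So \<open>Zmod n l\<close> is spanned by the basis tensors
  of weight \<open>l\<close>; because \<open>\<zeta>\<close> is primitive, it is also the eigenspace of \<open>g\<close> for \<open>\<zeta> ^ l\<close>
  (\<open>Zmod_eq_coord_space\<close>, \<open>coord_space_weight_eigenspace\<close>).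

  The eigenspaces decompose the tensor power, and operators commuting with the group preserve them;
  conversely every matrix unit between basis tensors of equal weight commutes with the group. The
  latter makes each eigenspace irreducible for the centralizer algebra
  (\<open>irreducible_coord_space\<close>), the former gives the bimodule decomposition
  (\<open>bimodule_decomposition\<close>).

  Irreducible submodules for the group are lines inside eigenspaces
  (\<open>irreducible_submodule_is_line\<close>). In any decomposition into such lines, those inside one
  eigenspace give a basis of it (\<open>card_lines_in_coord_space\<close>), so the multiplicity of the character
  \<open>l\<close> is the dimension of \<open>Zmod n l\<close>. That dimension is the number of sign sequences with
  \<open>\<bar>r\<bar> \<equiv> a_min n k l\<close> modulo \<open>n_tilde n\<close>, a sum of binomial coefficients; a sign sequence is also
  the step sequence of a walk, whose endpoint is its weight, and reducing \<open>(1 + z)\<^sup>k\<close> modulo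
  \<open>z\<^sup>m - 1\<close> with \<open>m = n_tilde n\<close> collects the same binomial coefficients (\<open>card_walks\<close>, \<open>cyclic_coeff_binomial\<close>).
\<close>

section \<open>Coordinate subspaces\<close>

text \<open>
  The index set of a coordinate space is graded by a function \<open>f\<close>; the vectors supported in one
  degree form a homogeneous component. The type of degrees is arbitrary: it will be the exponents
  of a character, but also the set of coordinate lines itself.
\<close>

definition coord_space :: "('s::finite \<Rightarrow> 'i) \<Rightarrow> 'i \<Rightarrow> (complex^'s) set" where
  "coord_space f j = {x. \<forall>s. f s \<noteq> j \<longrightarrow> x $ s = 0}"

definition coord_proj :: "('s::finite \<Rightarrow> 'i) \<Rightarrow> 'i \<Rightarrow> complex^'s \<Rightarrow> complex^'s" where
  "coord_proj f j x = (\<chi> s. if f s = j then x $ s else 0)"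

lemma subspace_coord_space: "vec.subspace (coord_space f j)"
  by (auto simp: vec.subspace_def coord_space_def)

lemma coord_proj_in: "coord_proj f j x \<in> coord_space f j"
  by (simp add: coord_proj_def coord_space_def)

lemma coord_proj_add: "coord_proj f j (x + y) = coord_proj f j x + coord_proj f j y"
  by (simp add: coord_proj_def vec_eq_iff)

lemma coord_proj_scale: "coord_proj f j (c *s x) = c *s coord_proj f j x"
  by (simp add: coord_proj_def vec_eq_iff)

lemma coord_proj_on_coord_space:
  "x \<in> coord_space f i \<Longrightarrow> coord_proj f j x = (if i = j then x else 0)"
  by (auto simp: coord_proj_def coord_space_def vec_eq_iff)

lemma coord_proj_sum: "coord_proj f j (sum g A) = (\<Sum>a\<in>A. coord_proj f j (g a))"
  by (simp add: coord_proj_def vec_eq_iff)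

lemma coord_proj_of_sum:
  assumes "finite I" and "\<And>i. i \<in> I \<Longrightarrow> w i \<in> coord_space f i" and "j \<in> I"
  shows "coord_proj f j (\<Sum>i\<in>I. w i) = w j"
proof -
  have "(\<Sum>i\<in>I. coord_proj f j (w i)) = (\<Sum>i\<in>I. if i = j then w i else 0)"
    by (intro sum.cong) (simp_all add: assms(2) coord_proj_on_coord_space)
  then show ?thesis
    using assms by (simp add: coord_proj_sum)
qed

lemma sum_coord_proj:
  assumes "finite I" and "range f \<subseteq> I"
  shows "(\<Sum>i\<in>I. coord_proj f i x) = x"
  using assms by (auto simp: coord_proj_def vec_eq_iff)

lemma restrict_coord_proj_of_sum:
  assumes "finite I" and "w \<in> Pi\<^sub>E I (coord_space f)"
  shows "(\<lambda>j\<in>I. coord_proj f j (\<Sum>i\<in>I. w i)) = w"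
  using assms(2) by (intro extensionalityI[of _ I])
    (auto simp: coord_proj_of_sum[OF assms(1)] PiE_iff)

lemma coord_proj_bij:
  assumes "finite I" and "range f \<subseteq> I"
  shows "bij_betw (\<lambda>x. \<lambda>i\<in>I. coord_proj f i x) UNIV (Pi\<^sub>E I (coord_space f))"
  by (rule bij_betw_byWitness[where f' = "\<lambda>w. \<Sum>i\<in>I. w i"])
    (use assms in \<open>auto simp: sum_coord_proj coord_proj_in restrict_coord_proj_of_sum\<close>)

lemma internal_direct_sum_coord_space:
  assumes "finite I" and "range f \<subseteq> I"
  shows "internal_direct_sum I (coord_space f) UNIV"
proof -
  have "bij_betw (\<lambda>w. \<Sum>i\<in>I. w i) (Pi\<^sub>E I (coord_space f)) UNIV"
    by (rule bij_betw_byWitness[where f' = "\<lambda>x. \<lambda>i\<in>I. coord_proj f i x"])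
      (use assms in \<open>auto simp: sum_coord_proj coord_proj_in restrict_coord_proj_of_sum\<close>)
  then show ?thesis
    using assms by (simp add: internal_direct_sum_def subspace_coord_space)
qed

text \<open>
  A subspace given only through the coordinate vectors that it contains is recognised by this
  criterion; it serves both to compute spans and to prove irreducibility.
\<close>

lemma in_subspace_if_axes_in:
  assumes "\<And>s. x $ s \<noteq> 0 \<Longrightarrow> axis s 1 \<in> U" and "vec.subspace U"
  shows "x \<in> (U :: (complex^'s::finite) set)"
proof -
  have "x $ s *s axis s 1 \<in> U" for s
    using assms by (cases "x $ s = 0") (auto intro: vec.subspace_scale vec.subspace_0)
  then have "(\<Sum>s\<in>UNIV. x $ s *s axis s 1) \<in> U"
    using assms(2) by (intro vec.subspace_sum) auto
  then show ?thesis
    by (simp add: basis_expansion)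
qed

lemma span_axis_eq_coord_space:
  "vec.span ((\<lambda>s. axis s 1) ` {s. f s = j}) = coord_space f j"
proof
  show "vec.span ((\<lambda>s. axis s 1) ` {s. f s = j}) \<subseteq> coord_space f j"
    by (rule vec.span_minimal) (auto simp: coord_space_def axis_def intro: subspace_coord_space[unfolded coord_space_def])
  show "coord_space f j \<subseteq> vec.span ((\<lambda>s. axis s 1) ` {s. f s = j})"
  proof
    fix x assume "x \<in> coord_space f j"
    then show "x \<in> vec.span ((\<lambda>s. axis s 1) ` {s. f s = j})"
      by (intro in_subspace_if_axes_in[OF vec.span_base] vec.subspace_span)
        (auto simp: coord_space_def)
  qed
qed

lemma dim_coord_space: "vec.dim (coord_space f j) = card {s. f s = j}"
proof -
  have "vec.independent ((\<lambda>s. axis s 1 :: complex^'a) ` {s. f s = j})"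
    by (rule vec.independent_mono[OF independent_cart_basis]) (auto simp: cart_basis_def)
  moreover have "inj_on (\<lambda>s. axis s 1 :: complex^'a) {s. f s = j}"
    by (auto simp: inj_on_def axis_eq_axis)
  ultimately show ?thesis
    unfolding span_axis_eq_coord_space[symmetric]
    by (simp add: vec.dim_eq_card_independent card_image)
qed

text \<open>
  An operator that respects the homogeneous components acts on each of the summands of
  \<open>x = (\<Sum>i. coord_proj f i x)\<close> separately, so comparing components of degree \<open>j\<close> gives the claim.
\<close>

lemma linear_commutes_coord_proj:
  assumes T: "Vector_Spaces.linear (*s) (*s) T"
    and inv: "\<And>i x. x \<in> coord_space f i \<Longrightarrow> T x \<in> coord_space f i"
  shows "coord_proj f j (T x) = T (coord_proj f j x)"
proof (cases "j \<in> range f")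
  case True
  interpret Vector_Spaces.linear "(*s)" "(*s)" T by fact
  have "T x = (\<Sum>i\<in>range f. T (coord_proj f i x))"
    by (subst sum_coord_proj[of "range f" f x, symmetric]) (simp_all add: sum)
  also have "coord_proj f j \<dots> = T (coord_proj f j x)"
    using True by (intro coord_proj_of_sum) (auto intro: inv coord_proj_in)
  finally show ?thesis .
next
  case False
  interpret Vector_Spaces.linear "(*s)" "(*s)" T by fact
  have "coord_proj f j y = 0" for y
    using False by (auto simp: coord_proj_def vec_eq_iff)
  then show ?thesis by (simp add: zero)
qed

section \<open>The weight decomposition\<close>

text \<open>
  The first basis vector of \<open>\<complex>\<^sup>2\<close> is \<open>vbasis (-1)\<close>, so for the index \<open>s\<close> of a basis tensor, \<open>ones s\<close>
  is the number \<open>\<bar>r\<bar>\<close> of entries \<open>-1\<close> of the corresponding sign sequence \<open>r\<close>.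
\<close>

definition ones :: "('k::finite \<Rightarrow> 2) \<Rightarrow> nat" where
  "ones s = card {i. s i = 1}"

text \<open>
  The generator multiplies each factor \<open>vbasis (-1)\<close> by \<open>inverse \<zeta>\<close> and each factor \<open>vbasis 1\<close> by
  \<open>\<zeta>\<close>, hence a basis tensor by \<open>\<zeta>\<close> to the power \<open>k - 2 \<bar>r\<bar>\<close>. Only the residue of this exponent
  modulo \<open>n\<close> matters.
\<close>

definition weight :: "nat \<Rightarrow> ('k::finite \<Rightarrow> 2) \<Rightarrow> nat" where
  "weight n s = nat ((int CARD('k) - 2 * int (ones s)) mod int n)"

lemma ones_le: "ones (s :: 'k::finite \<Rightarrow> 2) \<le> CARD('k)"
  unfolding ones_def by (rule card_mono) auto

lemma card_ones: "card {s :: 'k::finite \<Rightarrow> 2. ones s = b} = CARD('k) choose b"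
proof -
  have "card {s :: 'k \<Rightarrow> 2. ones s = b} = card {X :: 'k set. X \<subseteq> UNIV \<and> card X = b}"
  proof (rule bij_betw_same_card[of "\<lambda>s. {i. s i = 1}"], rule bij_betw_byWitness[where f' = "\<lambda>X i. if i \<in> X then 1 else 2"])
    show "\<forall>s\<in>{s :: 'k \<Rightarrow> 2. ones s = b}. (\<lambda>i. if i \<in> {i. s i = 1} then 1 else 2) = s"
      using exhaust_2 by (auto simp: fun_eq_iff)
  qed (auto simp: ones_def)
  also have "\<dots> = CARD('k) choose b"
    using n_subsets[of "UNIV :: 'k set" b] by simp
  finally show ?thesis .
qed

lemma int_weight: "n \<ge> 1 \<Longrightarrow> int (weight n (s :: 'k::finite \<Rightarrow> 2)) = (int CARD('k) - 2 * int (ones s)) mod int n"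
  by (simp add: weight_def)

lemma weight_eq_iff:
  assumes "j < n"
  shows "weight n (s :: 'k::finite \<Rightarrow> 2) = j \<longleftrightarrow> [int CARD('k) - 2 * int (ones s) = int j] (mod int n)"
proof -
  have "weight n s = j \<longleftrightarrow> int (weight n s) = int j" by simp
  also have "\<dots> \<longleftrightarrow> [int CARD('k) - 2 * int (ones s) = int j] (mod int n)"
    using assms by (simp add: int_weight cong_def)
  finally show ?thesis .
qed

lemma weight_in_Lambda: "n \<ge> 1 \<Longrightarrow> weight n (s :: 'k::finite \<Rightarrow> 2) \<in> Lambda n CARD('k)"
proof -
  assume n: "n \<ge> 1"
  have "[int (weight n s) = int CARD('k) - 2 * int (ones s)] (mod int n)"
    using n by (simp add: int_weight cong_def)
  moreover have "int (weight n s) < int n"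
    using n by (simp add: int_weight)
  ultimately show ?thesis
    using ones_le[of s] by (auto simp: Lambda_def)
qed

lemma finite_Lambda: "finite (Lambda n k)"
  by (rule finite_subset[of _ "{..<n}"]) (auto simp: Lambda_def)

text \<open>
  This is why \<open>n_tilde\<close> appears: \<open>2\<close> can be cancelled modulo an odd \<open>n\<close>, while for even \<open>n\<close>
  cancelling it halves the modulus.
\<close>

lemma double_cong_n_tilde:
  assumes "n \<ge> 1"
  shows "[2 * int a = 2 * int b] (mod int n) \<longleftrightarrow> [a = b] (mod n_tilde n)"
proof (cases "odd n")
  case True
  then have "coprime 2 (int n)" by simp
  then show ?thesis
    using True by (simp add: cong_mult_lcancel n_tilde_def cong_int_iff)
next
  case False
  then obtain m where m: "n = 2 * m" by blast
  have "[2 * int a = 2 * int b] (mod int n) \<longleftrightarrow> [int a = int b] (mod int m)"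
    by (simp add: m cong_def mult_mod_right[symmetric])
  then show ?thesis
    using m by (simp add: n_tilde_def cong_int_iff)
qed

lemma a_min_cong:
  assumes "l \<in> Lambda n k"
  shows "a_min n k l \<le> k" and "[int k - 2 * int (a_min n k l) = int l] (mod int n)"
proof -
  have "\<exists>a. a \<le> k \<and> [int k - 2 * int a = int l] (mod int n)"
    using assms by (auto simp: Lambda_def cong_sym)
  from LeastI_ex[OF this]
  show "a_min n k l \<le> k" and "[int k - 2 * int (a_min n k l) = int l] (mod int n)"
    by (auto simp: a_min_def)
qed

text \<open>
  The exponent \<open>k - 2 a\<close> meets the class of \<open>l\<close> at \<open>a = a_min n k l\<close>, so it does so at exactly those
  \<open>a\<close> whose double differs from that of \<open>a_min n k l\<close> by a multiple of \<open>n\<close>.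
\<close>

lemma cong_a_min_iff:
  assumes "n \<ge> 1" and "l \<in> Lambda n k"
  shows "[int k - 2 * int a = int l] (mod int n) \<longleftrightarrow> [a = a_min n k l] (mod n_tilde n)"
proof -
  have "[int k - 2 * int a = int l] (mod int n) \<longleftrightarrow>
      [int k - 2 * int a = int k - 2 * int (a_min n k l)] (mod int n)"
    using a_min_cong(2)[OF assms(2)] by (meson cong_sym cong_trans)
  also have "\<dots> \<longleftrightarrow> [2 * int a = 2 * int (a_min n k l)] (mod int n)"
    by (simp add: cong_diff_iff_cong_0 cong_iff_dvd_diff) (metis dvd_minus_iff minus_diff_eq)
  finally show ?thesis
    using double_cong_n_tilde[OF assms(1)] by simp
qed

lemma weight_eq_iff_ones:
  assumes "n \<ge> 1" and "l \<in> Lambda n CARD('k::finite)"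
  shows "weight n (s :: 'k \<Rightarrow> 2) = l \<longleftrightarrow> [ones s = a_min n CARD('k) l] (mod n_tilde n)"
proof -
  have "l < n" using assms by (simp add: Lambda_def)
  from weight_eq_iff[OF this, of s] show ?thesis
    by (simp add: cong_a_min_iff[OF assms])
qed

lemma ex_weight:
  assumes "n \<ge> 1" and "l \<in> Lambda n CARD('k::finite)"
  shows "\<exists>s :: 'k \<Rightarrow> 2. weight n s = l"
proof -
  let ?a = "a_min n CARD('k) l"
  have "card {s :: 'k \<Rightarrow> 2. ones s = ?a} > 0"
    using a_min_cong(1)[OF assms(2)] by (simp add: card_ones)
  then obtain s :: "'k \<Rightarrow> 2" where "ones s = ?a"
    by (auto simp: card_gt_0_iff)
  then show ?thesis
    using weight_eq_iff_ones[OF assms, of s] by auto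
qed

lemma tensor_vbasis:
  assumes "r \<in> sign_seqs"
  shows "tensor_vecs (\<lambda>i. vbasis (r i)) = axis (\<lambda>i. if r i = -1 then 1 else 2) 1"
proof -
  have "vbasis (r i) $ j = (if j = (if r i = -1 then 1 else 2) then 1 else 0)" for i j
    using exhaust_2[of j] by (auto simp: vbasis_def)
  then show ?thesis
    by (auto simp: tensor_vecs_def axis_def vec_eq_iff fun_eq_iff)
qed

text \<open>
  The basis tensors of the spanning set are coordinate vectors, and the congruence on the number of
  entries \<open>-1\<close> says that their index has weight \<open>l\<close>. From here on \<open>Zmod n l\<close> is a homogeneous
  component of the coordinate space.
\<close>

lemma Zmod_eq_coord_space:
  assumes "n \<ge> 1" and "l \<in> Lambda n CARD('k::finite)"
  shows "(Zmod n l :: (complex^('k \<Rightarrow> 2)) set) = coord_space (weight n) l"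
proof -
  let ?s = "\<lambda>(r :: 'k \<Rightarrow> int) i. if r i = -1 then 1 else (2::2)"
  let ?r = "\<lambda>(s :: 'k \<Rightarrow> 2) i. if s i = 1 then -1 else (1::int)"
  have ones: "ones (?s r) = neg_count r" for r
    unfolding ones_def neg_count_def by (rule arg_cong[where f = card]) auto
  have rs: "?s (?r s) = s" and r_sign: "?r s \<in> sign_seqs" for s
    using exhaust_2 by (auto simp: fun_eq_iff sign_seqs_def)
  have "{tensor_vecs (\<lambda>i. vbasis (r i)) | r.
         r \<in> sign_seqs \<and> [neg_count r = a_min n CARD('k) l] (mod n_tilde n)}
      = (\<lambda>s :: 'k \<Rightarrow> 2. axis s 1) ` {s. weight n s = l}"  (is "?L = ?R")
  proof
    show "?L \<subseteq> ?R"
    proof safe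
      fix r :: "'k \<Rightarrow> int"
      assume r: "r \<in> sign_seqs" "[neg_count r = a_min n CARD('k) l] (mod n_tilde n)"
      then have "weight n (?s r) = l"
        using weight_eq_iff_ones[OF assms, of "?s r"] by (simp only: ones)
      then show "tensor_vecs (\<lambda>i. vbasis (r i)) \<in> ?R"
        unfolding tensor_vbasis[OF r(1)] by blast
    qed
    show "?R \<subseteq> ?L"
    proof
      fix x :: "complex^('k \<Rightarrow> 2)" assume "x \<in> ?R"
      then obtain s where s: "x = axis s 1" "weight n s = l" by auto
      have "[neg_count (?r s) = a_min n CARD('k) l] (mod n_tilde n)"
        using s(2) weight_eq_iff_ones[OF assms] ones[of "?r s"] unfolding rs by simp
      moreover have "x = tensor_vecs (\<lambda>i. vbasis (?r s i))"
        unfolding tensor_vbasis[OF r_sign] rs s(1) ..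
      ultimately show "x \<in> ?L"
        using r_sign[of s] by (intro CollectI exI[of _ "?r s"] conjI)
    qed
  qed
  then show ?thesis
    by (simp add: Zmod_def span_axis_eq_coord_space)
qed

section \<open>The action of the cyclic group in coordinates\<close>

lemma cyc_gen_mult: "cyc_gen u ** cyc_gen v = cyc_gen (u * v)"
  by (simp add: cyc_gen_def vec_eq_iff forall_2 matrix_matrix_mult_def sum_2)

lemma cyc_gen_1: "cyc_gen 1 = mat 1"
  by (simp add: cyc_gen_def vec_eq_iff forall_2 mat_def)

text \<open>
  Natural exponents suffice because \<open>\<zeta>\<close> has finite order: the inverse of the generator is its
  power with exponent \<open>n - 1\<close>.
\<close>

lemma cyc_group_powers:
  assumes "primitive_root_of_unity n \<zeta>" and "n \<ge> 1"
  shows "cyc_group \<zeta> = {cyc_gen (\<zeta> ^ m) | m. True}"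
proof
  interpret group SU2 by (rule group_SU2)
  have z: "\<zeta> ^ n = 1" using assms by (simp add: primitive_root_of_unity_def)
  have powers: "cyc_gen (\<zeta> ^ m) \<in> cyc_group \<zeta>" for m
  proof (induction m)
    case 0
    have "\<one>\<^bsub>SU2\<^esub> \<in> cyc_group \<zeta>" unfolding cyc_group_def by (rule generate.one)
    then show ?case by (simp add: SU2_def cyc_gen_1)
  next
    case (Suc m)
    have "cyc_gen \<zeta> \<in> cyc_group \<zeta>" unfolding cyc_group_def by (rule generate.incl) simp
    from generate.eng[OF this[unfolded cyc_group_def] Suc[unfolded cyc_group_def]]
    show ?case by (simp add: SU2_def cyc_gen_mult cyc_group_def)
  qed
  show "cyc_group \<zeta> \<subseteq> {cyc_gen (\<zeta> ^ m) | m. True}"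
  proof
    fix h assume "h \<in> cyc_group \<zeta>"
    then show "h \<in> {cyc_gen (\<zeta> ^ m) | m. True}"
      unfolding cyc_group_def
    proof (induction rule: generate.induct)
      case one
      have "\<one>\<^bsub>SU2\<^esub> = cyc_gen (\<zeta> ^ 0)" by (simp add: SU2_def cyc_gen_1)
      then show ?case by blast
    next
      case (incl h)
      then have "h = cyc_gen (\<zeta> ^ 1)" by simp
      then show ?case by blast
    next
      case (inv h)
      have \<zeta>: "\<zeta> ^ (n - 1) * \<zeta> = 1"
        using z assms(2) by (metis power_minus_mult less_le_trans zero_less_one)
      have "cyc_gen (\<zeta> ^ (n - 1)) \<in> carrier SU2"
        using powers[of "n - 1"] generate_in_carrier[of "{cyc_gen \<zeta>}"] cyc_gen_in_SU2[OF assms]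
        unfolding cyc_group_def by blast
      then have "inv\<^bsub>SU2\<^esub> h = cyc_gen (\<zeta> ^ (n - 1))"
        using inv cyc_gen_in_SU2[OF assms] \<zeta>
        by (intro inv_equality) (simp_all add: SU2_def cyc_gen_mult cyc_gen_1)
      then show ?case by blast
    next
      case (eng h1 h2)
      then obtain a b where "h1 = cyc_gen (\<zeta> ^ a)" "h2 = cyc_gen (\<zeta> ^ b)" by auto
      then have "h1 \<otimes>\<^bsub>SU2\<^esub> h2 = cyc_gen (\<zeta> ^ (a + b))"
        by (simp add: SU2_def cyc_gen_mult power_add)
      then show ?case by blast
    qed
  qed
  show "{cyc_gen (\<zeta> ^ m) | m. True} \<subseteq> cyc_group \<zeta>"
    using powers by auto
qed

lemma primitive_root_nonzero:
  "primitive_root_of_unity n \<zeta> \<Longrightarrow> n \<ge> 1 \<Longrightarrow> \<zeta> \<noteq> 0"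
  by (auto simp: primitive_root_of_unity_def zero_power)

lemma primitive_root_power_inj:
  assumes "primitive_root_of_unity n \<zeta>" and "i < n" and "j < n" and "\<zeta> ^ i = \<zeta> ^ j"
  shows "i = j"
proof -
  have no: False if "a < b" "b < n" "\<zeta> ^ a = \<zeta> ^ b" for a b
  proof -
    have "\<zeta> ^ (b - a) = 1"
      using that primitive_root_nonzero[OF assms(1)] by (simp add: power_diff)
    then show False
      using assms(1) that unfolding primitive_root_of_unity_def
      by (metis less_imp_diff_less zero_less_diff)
  qed
  show ?thesis
    using no[of i j] no[of j i] assms by (cases i j rule: linorder_cases) auto
qed

lemma power_int_mod_root:
  assumes "\<zeta> ^ n = (1::complex)" and "n \<ge> 1"
  shows "\<zeta> powi (a mod int n) = \<zeta> powi a"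
proof -
  have z: "\<zeta> \<noteq> 0" using assms by (auto simp: zero_power)
  have "\<zeta> powi a = \<zeta> powi (int n * (a div int n) + a mod int n)" by simp
  also have "\<dots> = (\<zeta> ^ n) powi (a div int n) * \<zeta> powi (a mod int n)"
    using z by (simp only: power_int_add power_int_mult power_int_of_nat simp_thms)
  finally show ?thesis using assms by simp
qed

lemma diag_action_cyc_gen:
  assumes "u \<noteq> 0"
  shows "diag_action (cyc_gen u) x $ (s :: 'k::finite \<Rightarrow> 2)
    = u powi (int CARD('k) - 2 * int (ones s)) * x $ s"
proof -
  let ?d = "\<lambda>j::2. if j = 1 then inverse u else u"
  have g: "cyc_gen u $ a $ b = (if b = a then ?d a else 0)" for a b
    using exhaust_2[of a] exhaust_2[of b] by (auto simp: cyc_gen_def)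
  have "(\<Prod>i\<in>UNIV. cyc_gen u $ s i $ t i) = (if t = s then \<Prod>i\<in>UNIV. ?d (s i) else 0)" for t
  proof (cases "t = s")
    case False
    then obtain i where "t i \<noteq> s i" by (auto simp: fun_eq_iff)
    then have "cyc_gen u $ s i $ t i = 0" by (simp add: g)
    then show ?thesis using False by (auto intro!: prod_zero)
  qed (simp add: g)
  then have "diag_action (cyc_gen u) x $ s = (\<Prod>i\<in>UNIV. ?d (s i)) * x $ s"
    by (simp add: diag_action_def matrix_vector_mult_def if_distrib[of "\<lambda>c. c * _"] cong: if_cong)
  also have "(\<Prod>i\<in>UNIV. ?d (s i)) = (\<Prod>i\<in>{i. s i = 1}. inverse u) * (\<Prod>i\<in>-{i. s i = 1}. u)"
    by (simp add: prod.If_cases)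
  also have "\<dots> = u powi (- int (ones s)) * u powi (int (CARD('k) - ones s))"
    by (simp add: ones_def Compl_eq_Diff_UNIV card_Diff_subset power_int_minus power_inverse)
  also have "\<dots> = u powi (int CARD('k) - 2 * int (ones s))"
    using assms ones_le[of s] by (simp add: power_int_add[symmetric] of_nat_diff)
  finally show ?thesis .
qed

lemma diag_action_cyc_gen_weight:
  assumes "primitive_root_of_unity n \<zeta>" and "n \<ge> 1"
  shows "diag_action (cyc_gen (\<zeta> ^ m)) x $ (s :: 'k::finite \<Rightarrow> 2) = \<zeta> ^ (m * weight n s) * x $ s"
proof -
  have z: "\<zeta> \<noteq> 0" and zn: "\<zeta> ^ n = 1"
    using assms primitive_root_nonzero by (auto simp: primitive_root_of_unity_def)
  have "(\<zeta> ^ m) powi (int CARD('k) - 2 * int (ones s))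
      = (\<zeta> powi (int CARD('k) - 2 * int (ones s))) ^ m"
    by (metis mult.commute power_int_mult power_int_of_nat)
  also have "\<dots> = \<zeta> ^ (m * weight n s)"
    unfolding power_int_mod_root[OF zn assms(2), of "int CARD('k) - 2 * int (ones s)", symmetric]
      int_weight[OF assms(2), of s, symmetric]
    by (simp add: power_mult mult.commute[of m])
  finally show ?thesis
    using z by (simp add: diag_action_cyc_gen)
qed

lemma linear_vecI:
  fixes T :: "complex^'a::finite \<Rightarrow> complex^'b::finite"
  assumes "\<And>x y. T (x + y) = T x + T y" and "\<And>c x. T (c *s x) = c *s T x"
  shows "Vector_Spaces.linear (*s) (*s) T"
  by unfold_locales (rule assms)+

text \<open>
  Distinct weights below \<open>n\<close> give distinct powers of the primitive root, so a coordinate of an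
  eigenvector for \<open>\<zeta> ^ j\<close> can only be nonzero where the weight is \<open>j\<close>.
\<close>

lemma coord_space_weight_eigenspace:
  assumes "primitive_root_of_unity n \<zeta>" and "j < n"
  shows "x \<in> coord_space (weight n) j \<longleftrightarrow> diag_action (cyc_gen \<zeta>) x = \<zeta> ^ j *s x"
proof -
  have n: "n \<ge> 1" using assms by simp
  have "weight n s < n" for s :: "'a \<Rightarrow> 2"
    using weight_in_Lambda[OF n, of s] by (simp add: Lambda_def)
  then have "\<zeta> ^ weight n s * x $ s = \<zeta> ^ j * x $ s \<longleftrightarrow> (weight n s = j \<or> x $ s = 0)" for s
    using primitive_root_power_inj[OF assms(1) _ assms(2)] by auto
  then show ?thesis
    using diag_action_cyc_gen_weight[OF assms(1) n, of 1 x]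
    by (auto simp: coord_space_def vec_eq_iff)
qed

lemma diag_action_on_coord_space:
  assumes "primitive_root_of_unity n \<zeta>" and "n \<ge> 1" and "x \<in> coord_space (weight n) j"
  shows "diag_action (cyc_gen (\<zeta> ^ m)) x = \<zeta> ^ (m * j) *s x"
proof -
  have "\<zeta> ^ (m * weight n s) * x $ s = \<zeta> ^ (m * j) * x $ s" for s
    using assms(3) by (cases "weight n s = j") (auto simp: coord_space_def)
  then show ?thesis
    by (simp only: vec_eq_iff diag_action_cyc_gen_weight[OF assms(1,2)] vector_smult_component)
      simp
qed

section \<open>The centralizer algebra\<close>

text \<open>
  Operators commuting with the generator preserve its eigenspaces.
\<close>

lemma End_group_preserves_coord_space:
  assumes \<zeta>: "primitive_root_of_unity n \<zeta>" and n: "n \<ge> 1"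
    and T: "T \<in> End_group (cyc_group \<zeta>) diag_action"
    and x: "x \<in> coord_space (weight n) j"
  shows "T x \<in> coord_space (weight n) j"
proof (cases "j < n")
  case True
  interpret Vector_Spaces.linear "(*s)" "(*s)" T using T by (simp add: End_group_def)
  have "cyc_gen \<zeta> \<in> cyc_group \<zeta>"
    unfolding cyc_group_def by (rule generate.incl) simp
  then have "diag_action (cyc_gen \<zeta>) (T x) = T (diag_action (cyc_gen \<zeta>) x)"
    using T by (simp add: End_group_def)
  also have "diag_action (cyc_gen \<zeta>) x = \<zeta> ^ j *s x"
    using x coord_space_weight_eigenspace[OF \<zeta> True] by blast
  finally show ?thesis
    by (simp add: coord_space_weight_eigenspace[OF \<zeta> True] scale)
next
  \<comment> \<open>Degrees that are not residues do not occur as weights, so their component is zero.\<close>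
  case False
  have "weight n s \<noteq> j" for s :: "'a \<Rightarrow> 2"
    using weight_in_Lambda[OF n, of s] False by (auto simp: Lambda_def)
  then have "x = 0" using x by (simp add: coord_space_def vec_eq_iff)
  interpret Vector_Spaces.linear "(*s)" "(*s)" T using T by (simp add: End_group_def)
  show ?thesis by (simp add: \<open>x = 0\<close> zero coord_space_def)
qed

text \<open>
  Two basis tensors of equal weight span isomorphic lines, so a matrix unit between them is
  equivariant. The irreducibility of the homogeneous components rests on these operators.
\<close>

lemma matrix_unit_in_End_group:
  assumes "primitive_root_of_unity n \<zeta>" and "n \<ge> 1" and "weight n s = weight n t"
  shows "(\<lambda>x. x $ s *s axis t 1) \<in> End_group (cyc_group \<zeta>) diag_action"
proof -
  have "Vector_Spaces.linear (*s) (*s) (\<lambda>x :: complex^('a \<Rightarrow> 2). x $ s *s axis t 1)"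
    by (rule linear_vecI) (simp_all add: vec_eq_iff ring_distribs)
  moreover have "diag_action (cyc_gen (\<zeta> ^ m)) x $ s *s axis t 1
      = diag_action (cyc_gen (\<zeta> ^ m)) (x $ s *s axis t 1)" for x m
    using assms(3) by (simp add: vec_eq_iff axis_def diag_action_cyc_gen_weight[OF assms(1,2)])
  ultimately show ?thesis
    by (auto simp: End_group_def cyc_group_powers[OF assms(1,2)])
qed

text \<open>
  If \<open>u\<close> in a submodule has a nonzero coordinate at \<open>t\<close>, the matrix units carry \<open>u\<close> to nonzero
  multiples of every coordinate vector of weight \<open>j\<close>, so the submodule is everything.
\<close>

lemma irreducible_coord_space:
  assumes \<zeta>: "primitive_root_of_unity n \<zeta>" and n: "n \<ge> 1" and s: "weight n (s :: 'k::finite \<Rightarrow> 2) = j"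
  shows "irreducible_module (End_group (cyc_group \<zeta>) diag_action)
    (coord_space (weight n) j :: (complex^('k \<Rightarrow> 2)) set)"
  unfolding irreducible_module_def
proof (intro conjI allI impI)
  show "is_submodule (End_group (cyc_group \<zeta>) diag_action)
      (coord_space (weight n) j :: (complex^('k \<Rightarrow> 2)) set)"
    using End_group_preserves_coord_space[OF \<zeta> n]
    by (auto simp: is_submodule_def intro: subspace_coord_space)
  have "axis s 1 \<in> (coord_space (weight n) j :: (complex^('k \<Rightarrow> 2)) set)"
    using s by (auto simp: coord_space_def axis_def)
  then show "(coord_space (weight n) j :: (complex^('k \<Rightarrow> 2)) set) \<noteq> {0}"
    by (metis axis_eq_0_iff singletonD zero_neq_one)
next
  fix U :: "(complex^('k \<Rightarrow> 2)) set"
  assume U: "is_submodule (End_group (cyc_group \<zeta>) diag_action) U \<and> U \<subseteq> coord_space (weight n) j"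
  then have sub: "vec.subspace U" by (simp add: is_submodule_def)
  show "U = {0} \<or> U = coord_space (weight n) j"
  proof (cases "U = {0}")
    case False
    then obtain u where "u \<in> U" "u \<noteq> 0"
      using vec.subspace_0[OF sub] by auto
    then obtain t where u: "u \<in> U" "u $ t \<noteq> 0"
      unfolding vec_eq_iff zero_index by blast
    then have t: "weight n t = j" using U by (auto simp: coord_space_def)
    have axis: "axis t' 1 \<in> U" if "weight n t' = j" for t'
    proof -
      have "u $ t *s axis t' 1 \<in> U"
        using U u(1) matrix_unit_in_End_group[OF \<zeta> n, of t t'] t that
        by (auto simp: is_submodule_def)
      from vec.subspace_scale[OF sub this, of "inverse (u $ t)"] show ?thesis
        using u(2) by (simp add: vector_smult_assoc)
    qed
    have "coord_space (weight n) j \<subseteq> U"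
      by (rule subsetI, rule in_subspace_if_axes_in[OF axis sub]) (auto simp: coord_space_def)
    then show ?thesis using U by blast
  qed simp
qed

section \<open>Bimodule decomposition\<close>

lemma tensor2_one: "tensor2 (u :: complex^1) w = tensor2 (axis 1 1) (u $ 1 *s w)"
proof -
  have "i = 1" for i :: 1 by (metis (full_types) num1_eq_iff)
  then show ?thesis by (simp add: tensor2_def vec_eq_iff axis_def)
qed

lemma linear_tensor2_right: "Vector_Spaces.linear (*s) (*s) (tensor2 u)"
  by (rule linear_vecI) (simp_all add: tensor2_def vec_eq_iff algebra_simps)

lemma inj_tensor2_one: "inj (tensor2 (axis 1 1 :: complex^1))"
proof (rule injI)
  fix x y :: "complex^'a" assume *: "tensor2 (axis 1 1 :: complex^1) x = tensor2 (axis 1 1) y"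
  have "x $ s = y $ s" for s
    using arg_cong[OF *, of "\<lambda>z. z $ (1, s)"] by (simp add: tensor2_def)
  then show "x = y" by (simp add: vec_eq_iff)
qed

lemma tensor_space_one:
  assumes "vec.subspace W"
  shows "tensor_space (UNIV :: (complex^1) set) W = tensor2 (axis 1 1) ` W"
proof -
  have "{tensor2 (u :: complex^1) w | u w. u \<in> UNIV \<and> w \<in> W} = tensor2 (axis 1 1) ` W"
  proof
    show "{tensor2 (u :: complex^1) w | u w. u \<in> UNIV \<and> w \<in> W} \<subseteq> tensor2 (axis 1 1) ` W"
    proof safe
      fix u :: "complex^1" and w assume "w \<in> W"
      then have "u $ 1 *s w \<in> W" using assms by (rule vec.subspace_scale[rotated])
      then show "tensor2 u w \<in> tensor2 (axis 1 1) ` W"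
        by (subst tensor2_one) (rule imageI)
    qed
  qed auto
  moreover have "vec.subspace (tensor2 (axis 1 1 :: complex^1) ` W)"
    using assms linear_tensor2_right by (rule vec.linear_subspace_image[rotated])
  ultimately show ?thesis
    by (simp add: tensor_space_def vec.span_eq_iff)
qed

text \<open>
  The isomorphism sends \<open>x\<close> to the family of its homogeneous parts, each tensored with the basis
  vector of the one-dimensional space \<open>complex ^ 1\<close>. The group acts on the part of degree \<open>j\<close> by
  a scalar, which may be moved to the first tensor factor; the centralizer commutes with the
  projections.
\<close>

lemma bimodule_decomposition:
  assumes \<zeta>: "primitive_root_of_unity n \<zeta>" and n: "n \<ge> 1"
    and I: "finite I" "range (weight n :: ('k::finite \<Rightarrow> 2) \<Rightarrow> nat) \<subseteq> I"
  shows "\<exists>\<Phi> :: complex^('k \<Rightarrow> 2) \<Rightarrow> nat \<Rightarrow> complex^(1 \<times> ('k \<Rightarrow> 2)).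
         linear_iso_to_direct_sum \<Phi> UNIV I (\<lambda>j. tensor_space UNIV (coord_space (weight n) j))
       \<and> (\<forall>h\<in>cyc_group \<zeta>. \<forall>x. \<forall>j\<in>I.
            \<Phi> (diag_action h x) j = tensor_map (char_action j h) id (\<Phi> x j))
       \<and> (\<forall>T\<in>End_group (cyc_group \<zeta>) diag_action. \<forall>x. \<forall>j\<in>I.
            \<Phi> (T x) j = tensor_map id T (\<Phi> x j))"
proof -
  let ?e = "tensor2 (axis 1 1 :: complex^1) :: complex^('k \<Rightarrow> 2) \<Rightarrow> _"
  let ?P = "coord_proj (weight n :: ('k \<Rightarrow> 2) \<Rightarrow> nat)"
  let ?C = "coord_space (weight n :: ('k \<Rightarrow> 2) \<Rightarrow> nat)"
  define \<Phi> where "\<Phi> x = (\<lambda>j\<in>I. ?e (?P j x))" for x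
  interpret e: Vector_Spaces.linear "(*s)" "(*s)" ?e by (rule linear_tensor2_right)
  have ts: "tensor_space (UNIV :: (complex^1) set) (?C j) = ?e ` ?C j" for j
    by (rule tensor_space_one[OF subspace_coord_space])
  have inv_e: "inv_into UNIV ?e (v j) \<in> ?C j \<and> ?e (inv_into UNIV ?e (v j)) = v j"
    if "v \<in> (\<Pi>\<^sub>E j\<in>I. ?e ` ?C j)" "j \<in> I" for v j
  proof -
    from that have "v j \<in> ?e ` ?C j" by blast
    then show ?thesis by (auto simp: inv_f_f[OF inj_tensor2_one])
  qed
  have "bij_betw (\<lambda>w. \<lambda>j\<in>I. ?e (w j)) (Pi\<^sub>E I ?C) (\<Pi>\<^sub>E j\<in>I. ?e ` ?C j)"
    by (rule bij_betw_byWitness[where f' = "\<lambda>v. \<lambda>j\<in>I. inv_into UNIV ?e (v j)"])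
      (auto simp: inv_f_f[OF inj_tensor2_one] inv_e PiE_mem intro!: extensionalityI[of _ I]
        simp: PiE_def)
  from bij_betw_trans[OF coord_proj_bij[OF I] this]
  have "bij_betw \<Phi> UNIV (\<Pi>\<^sub>E j\<in>I. ?e ` ?C j)"
    by (simp add: \<Phi>_def[abs_def] comp_def cong: restrict_cong)
  then have "linear_iso_to_direct_sum \<Phi> UNIV I (\<lambda>j. tensor_space UNIV (?C j))"
    using I(1) by (auto simp: linear_iso_to_direct_sum_def ts \<Phi>_def coord_proj_add coord_proj_scale
        e.add e.scale intro!: e.subspace_image subspace_coord_space)
  moreover have "\<Phi> (diag_action h x) j = tensor_map (char_action j h) id (\<Phi> x j)"
    if h: "h \<in> cyc_group \<zeta>" and j: "j \<in> I" for h x j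
  proof -
    obtain m where m: "h = cyc_gen (\<zeta> ^ m)"
      using h cyc_group_powers[OF \<zeta> n] by auto
    have lin: "Vector_Spaces.linear (*s) (*s) (char_action j h)"
      by (rule linear_vecI) (simp_all add: char_action_def vec.scale_right_distrib vector_smult_assoc mult.commute)
    have "char_action j h (axis 1 1) = \<zeta> ^ (m * j) *s axis 1 1"
      by (simp add: m char_action_cyc_gen power_mult)
    moreover have "?P j (diag_action h x) = \<zeta> ^ (m * j) *s ?P j x"
      by (simp add: m coord_proj_def vec_eq_iff diag_action_cyc_gen_weight[OF \<zeta> n])
    ultimately show ?thesis
      using j by (simp add: \<Phi>_def tensor_map_tensor2[OF lin vec.linear_id] e.scale)
        (simp add: tensor2_def vec_eq_iff)
  qed
  moreover have "\<Phi> (T x) j = tensor_map id T (\<Phi> x j)"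
    if T: "T \<in> End_group (cyc_group \<zeta>) diag_action" and j: "j \<in> I" for T x j
  proof -
    have lin: "Vector_Spaces.linear (*s) (*s) T" using T by (simp add: End_group_def)
    have "?P j (T x) = T (?P j x)"
      by (rule linear_commutes_coord_proj[OF lin End_group_preserves_coord_space[OF \<zeta> n T]])
    then show ?thesis
      using j by (simp add: \<Phi>_def tensor_map_tensor2[OF vec.linear_id lin])
  qed
  ultimately show ?thesis by blast
qed

section \<open>Multiplicities\<close>

lemma is_submodule_cyc_group_iff:
  assumes "primitive_root_of_unity n \<zeta>" and "n \<ge> 1"
  shows "is_submodule (diag_action ` cyc_group \<zeta>) W \<longleftrightarrow>
    vec.subspace W \<and> (\<forall>m. \<forall>x\<in>W. diag_action (cyc_gen (\<zeta> ^ m)) x \<in> W)"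
  by (auto simp: is_submodule_def cyc_group_powers[OF assms])

lemma line_submodule:
  assumes \<zeta>: "primitive_root_of_unity n \<zeta>" and n: "n \<ge> 1" and v: "v \<in> coord_space (weight n) j"
  shows "is_submodule (diag_action ` cyc_group \<zeta>) (vec.span {v})"
  unfolding is_submodule_cyc_group_iff[OF \<zeta> n]
proof (intro conjI allI ballI)
  fix m x assume x: "x \<in> vec.span {v}"
  have "vec.span {v} \<subseteq> coord_space (weight n) j"
    using v by (intro vec.span_minimal subspace_coord_space) auto
  then have "diag_action (cyc_gen (\<zeta> ^ m)) x = \<zeta> ^ (m * j) *s x"
    using x by (intro diag_action_on_coord_space[OF \<zeta> n]) auto
  then show "diag_action (cyc_gen (\<zeta> ^ m)) x \<in> vec.span {v}"
    using x by (simp add: vec.span_scale)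
qed simp

text \<open>
  A one-dimensional space has no subspaces besides itself and zero, let alone submodules.
\<close>

lemma irreducible_line:
  assumes \<zeta>: "primitive_root_of_unity n \<zeta>" and n: "n \<ge> 1" and v: "v \<in> coord_space (weight n) j"
    and "v \<noteq> 0"
  shows "irreducible_module (diag_action ` cyc_group \<zeta>) (vec.span {v})"
  unfolding irreducible_module_def
proof (intro conjI allI impI)
  show "vec.span {v} \<noteq> {0}"
    using \<open>v \<noteq> 0\<close> vec.span_base[of v "{v}"] by auto
next
  fix U assume "is_submodule (diag_action ` cyc_group \<zeta>) U \<and> U \<subseteq> vec.span {v}"
  then have U: "vec.subspace U" "U \<subseteq> vec.span {v}" by (auto simp: is_submodule_def)
  show "U = {0} \<or> U = vec.span {v}"
  proof (cases "U = {0}")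
    case False
    then obtain u where u: "u \<in> U" "u \<noteq> 0" using vec.subspace_0[OF U(1)] by auto
    then obtain c where c: "u = c *s v" using U(2) by (auto simp: vec.span_singleton)
    with u have "c \<noteq> 0" by auto
    have "inverse c *s u \<in> U" using U(1) u(1) by (rule vec.subspace_scale)
    then have "v \<in> U" using \<open>c \<noteq> 0\<close> by (simp add: c vector_smult_assoc)
    then have "vec.span {v} \<subseteq> U" using U(1) by (intro vec.span_minimal) auto
    then show ?thesis using U(2) by blast
  qed simp
qed (rule line_submodule[OF \<zeta> n v])

text \<open>
  A nonzero vector \<open>v\<close> of minimal support in an invariant subspace is homogeneous: if \<open>s\<close> is in its
  support, subtracting \<open>\<zeta> ^ weight n s *s v\<close> from its image under the generator cancels the
  coordinate at \<open>s\<close> and creates no new one, so the difference vanishes and \<open>v\<close> is an eigenvector.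
\<close>

lemma irreducible_submodule_is_line:
  fixes X :: "(complex^('k::finite \<Rightarrow> 2)) set"
  assumes \<zeta>: "primitive_root_of_unity n \<zeta>" and n: "n \<ge> 1"
    and X: "irreducible_module (diag_action ` cyc_group \<zeta>) X"
  obtains v j where "v \<noteq> 0" and "v \<in> coord_space (weight n) j" and "X = vec.span {v}"
proof -
  have inv: "diag_action (cyc_gen \<zeta>) x \<in> X" if "x \<in> X" for x
  proof -
    have "cyc_gen \<zeta> \<in> cyc_group \<zeta>"
      unfolding cyc_group_def by (rule generate.incl) simp
    then show ?thesis
      using X that unfolding irreducible_module_def is_submodule_def by blast
  qed
  have sub: "vec.subspace X" and "X \<noteq> {0}"
    using X by (auto simp: irreducible_module_def is_submodule_def)
  then obtain u where u: "u \<in> X \<and> u \<noteq> 0" using vec.subspace_0[OF sub] by auto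
  define supp where "supp x = {s. x $ s \<noteq> 0}" for x :: "complex^('k \<Rightarrow> 2)"
  obtain v where v: "v \<in> X" "v \<noteq> 0"
      and min: "\<And>y. y \<in> X \<Longrightarrow> y \<noteq> 0 \<Longrightarrow> card (supp v) \<le> card (supp y)"
    using ex_has_least_nat[of "\<lambda>v. v \<in> X \<and> v \<noteq> 0", OF u, of "\<lambda>v. card (supp v)"] by blast
  obtain s where s: "v $ s \<noteq> 0" using v(2) unfolding vec_eq_iff zero_index by blast
  let ?j = "weight n s"
  let ?y = "diag_action (cyc_gen \<zeta>) v - \<zeta> ^ ?j *s v"
  have y: "?y $ t = (\<zeta> ^ weight n t - \<zeta> ^ ?j) * v $ t" for t
    using diag_action_cyc_gen_weight[OF \<zeta> n, of 1 v t] by (simp add: algebra_simps)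
  have "?y \<in> X"
    using v(1) by (intro vec.subspace_diff[OF sub] vec.subspace_scale[OF sub] inv)
  moreover have "supp ?y \<subset> supp v"
  proof
    show "supp ?y \<subseteq> supp v" unfolding supp_def y by auto
    show "supp ?y \<noteq> supp v" using s y[of s] unfolding supp_def by auto
  qed
  then have "card (supp ?y) < card (supp v)" by (intro psubset_card_mono) auto
  ultimately have "?y = 0" using min[of ?y] by linarith
  moreover have "?j < n" using weight_in_Lambda[OF n, of s] by (simp add: Lambda_def)
  ultimately have hom: "v \<in> coord_space (weight n) ?j"
    by (simp add: coord_space_weight_eigenspace[OF \<zeta>])
  have "vec.span {v} \<subseteq> X" using v(1) sub by (intro vec.span_minimal) auto
  moreover have "vec.span {v} \<noteq> {0}" using v(2) vec.span_base[of v "{v}"] by auto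
  ultimately have "X = vec.span {v}"
    using X line_submodule[OF \<zeta> n hom] by (auto simp: irreducible_module_def)
  with v(2) hom show ?thesis by (rule that)
qed

text \<open>
  An isomorphism transports the eigenvalue of the generator. Conversely, a coordinate in which \<open>v\<close>
  does not vanish identifies the line through \<open>v\<close> with \<open>complex ^ 1\<close>.
\<close>

lemma module_iso_line_iff:
  assumes \<zeta>: "primitive_root_of_unity n \<zeta>" and n: "n \<ge> 1" and "l < n"
    and v: "v \<in> coord_space (weight n) j" "v \<noteq> 0"
  shows "module_iso (cyc_group \<zeta>) diag_action (vec.span {v}) (char_action l) UNIV
    \<longleftrightarrow> vec.span {v} \<subseteq> coord_space (weight n) l"
proof
  let ?X = "vec.span {v}" and ?g = "cyc_gen \<zeta>"
  assume "module_iso (cyc_group \<zeta>) diag_action ?X (char_action l) UNIV"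
  then obtain \<phi> where bij: "bij_betw \<phi> ?X UNIV"
    and scale: "\<And>c x. x \<in> ?X \<Longrightarrow> \<phi> (c *s x) = c *s \<phi> x"
    and eqv: "\<And>h x. h \<in> cyc_group \<zeta> \<Longrightarrow> x \<in> ?X \<Longrightarrow> \<phi> (diag_action h x) = char_action l h (\<phi> x)"
    by (auto simp: module_iso_def)
  have g: "?g \<in> cyc_group \<zeta>"
    unfolding cyc_group_def by (rule generate.incl) simp
  show "?X \<subseteq> coord_space (weight n) l"
  proof
    fix x assume x: "x \<in> ?X"
    have "\<phi> (diag_action ?g x) = \<phi> (\<zeta> ^ l *s x)"
      by (simp add: eqv[OF g x] scale[OF x] char_action_cyc_gen)
    moreover have "diag_action ?g x \<in> ?X"
      using line_submodule[OF \<zeta> n v(1)] g x by (auto simp: is_submodule_def)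
    moreover have "\<zeta> ^ l *s x \<in> ?X" using x by (rule vec.span_scale)
    ultimately have "diag_action ?g x = \<zeta> ^ l *s x"
      using bij unfolding bij_betw_def by (meson inj_onD)
    then show "x \<in> coord_space (weight n) l"
      by (simp add: coord_space_weight_eigenspace[OF \<zeta> \<open>l < n\<close>])
  qed
next
  let ?X = "vec.span {v}"
  assume sub: "?X \<subseteq> coord_space (weight n) l"
  obtain s where s: "v $ s \<noteq> 0" using v(2) unfolding vec_eq_iff zero_index by blast
  define \<phi> :: "_ \<Rightarrow> complex^1" where "\<phi> x = (\<chi> i. x $ s)" for x :: "complex^('a \<Rightarrow> 2)"
  have "bij_betw \<phi> ?X UNIV"
    by (rule bij_betw_byWitness[where f' = "\<lambda>y. (y $ 1 / v $ s) *s v"])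
      (use s in \<open>auto simp: \<phi>_def vec.span_singleton vec_eq_iff forall_1\<close>)
  moreover have "\<phi> (x + y) = \<phi> x + \<phi> y" "\<phi> (c *s x) = c *s \<phi> x" for x y c
    by (auto simp: \<phi>_def vec_eq_iff)
  moreover have "\<phi> (diag_action h x) = char_action l h (\<phi> x)"
    if h: "h \<in> cyc_group \<zeta>" and x: "x \<in> ?X" for h x
  proof -
    obtain m where "h = cyc_gen (\<zeta> ^ m)" using h cyc_group_powers[OF \<zeta> n] by auto
    moreover have "x \<in> coord_space (weight n) l" using x sub by blast
    ultimately show ?thesis
      by (simp add: diag_action_on_coord_space[OF \<zeta> n] char_action_cyc_gen power_mult)
        (simp add: \<phi>_def vec_eq_iff)
  qed
  ultimately show "module_iso (cyc_group \<zeta>) diag_action ?X (char_action l) UNIV"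
    unfolding module_iso_def by blast
qed

text \<open>
  Generators of those lines of the decomposition that lie in degree \<open>l\<close> form a basis of the
  component: they are independent because the sum is direct, and they span because the projection
  to degree \<open>l\<close> kills all other lines and fixes these. Hence their number does not depend on the
  decomposition.
\<close>

lemma card_lines_in_coord_space:
  assumes sum: "internal_direct_sum D (\<lambda>U. U) (UNIV :: (complex^'s::finite) set)"
    and lines: "\<And>X. X \<in> D \<Longrightarrow> \<exists>v j. v \<noteq> 0 \<and> v \<in> coord_space f j \<and> X = vec.span {v}"
  shows "card {X \<in> D. X \<subseteq> coord_space f l} = vec.dim (coord_space f l)"
proof -
  let ?C = "coord_space f"
  have fin: "finite D" and bij: "bij_betw (\<lambda>w. \<Sum>X\<in>D. w X) (\<Pi>\<^sub>E X\<in>D. X) UNIV"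
    and sub: "\<And>X. X \<in> D \<Longrightarrow> vec.subspace X"
    using sum by (auto simp: internal_direct_sum_def)
  obtain v j where v: "\<And>X. X \<in> D \<Longrightarrow> v X \<noteq> 0 \<and> v X \<in> ?C (j X) \<and> X = vec.span {v X}"
    using lines by metis
  define E where "E = {X \<in> D. X \<subseteq> ?C l}"
  have E: "finite E" "E \<subseteq> D" using fin by (auto simp: E_def)
  have E_iff: "X \<in> E \<longleftrightarrow> j X = l" if "X \<in> D" for X
  proof
    assume "j X = l"
    then have "vec.span {v X} \<subseteq> ?C l"
      using v[OF that] by (intro vec.span_minimal subspace_coord_space) auto
    then show "X \<in> E" using that v[OF that] by (simp add: E_def)
  next
    assume "X \<in> E"
    then have "v X \<in> ?C l"
      using v[OF that] vec.span_base[of "v X" "{v X}"] by (auto simp: E_def)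
    then have "coord_proj f l (v X) = v X" by (simp add: coord_proj_on_coord_space)
    then show "j X = l"
      using v[OF that] coord_proj_on_coord_space[of "v X" f "j X" l] by (auto split: if_splits)
  qed
  have inj: "inj_on v D" by (rule inj_onI) (metis v)
  have indep: "vec.independent (v ` E)"
  proof (rule vec.independent_if_scalars_zero)
    show "finite (v ` E)" using E by simp
    fix c x assume c: "(\<Sum>x\<in>v ` E. c x *s x) = 0" and "x \<in> v ` E"
    then obtain X where X: "X \<in> E" "x = v X" by blast
    \<comment> \<open>The directness is a statement about families over all of \<open>D\<close>, so the combination is extended by zero.\<close>
    define w where "w = (\<lambda>X\<in>D. if X \<in> E then c (v X) *s v X else 0)"
    have "c (v X) *s v X \<in> X" if "X \<in> D" for X
      using vec.span_scale[OF vec.span_base[of "v X" "{v X}"]] v[OF that] by simp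
    then have "w \<in> (\<Pi>\<^sub>E X\<in>D. X)"
      using vec.subspace_0[OF sub] by (auto simp: w_def)
    moreover have "(\<lambda>X\<in>D. 0) \<in> (\<Pi>\<^sub>E X\<in>D. X)"
      using vec.subspace_0[OF sub] by auto
    moreover have "(\<Sum>X\<in>D. w X) = (\<Sum>X\<in>E. c (v X) *s v X)"
      using E fin by (simp add: w_def sum.If_cases Int_absorb1)
    then have "(\<Sum>X\<in>D. w X) = (\<Sum>X\<in>D. (\<lambda>X\<in>D. 0) X)"
      using c inj_on_subset[OF inj E(2)] by (simp add: sum.reindex)
    ultimately have "w = (\<lambda>X\<in>D. 0)"
      using bij unfolding bij_betw_def by (meson inj_onD)
    from fun_cong[OF this, of X] have "c (v X) *s v X = 0"
      using X E by (auto simp: w_def)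
    then show "c x = 0" using X E v by auto
  qed
  have span: "?C l \<subseteq> vec.span (v ` E)"
  proof
    fix x assume x: "x \<in> ?C l"
    obtain w where w: "w \<in> (\<Pi>\<^sub>E X\<in>D. X)" and x_sum: "x = (\<Sum>X\<in>D. w X)"
      using bij unfolding bij_betw_def by (metis UNIV_I imageE)
    have wX: "w X \<in> vec.span {v X}" if "X \<in> D" for X using w v[OF that] that by auto
    have w_hom: "w X \<in> ?C (j X)" if "X \<in> D" for X
    proof -
      have "vec.span {v X} \<subseteq> ?C (j X)"
        using v[OF that] by (intro vec.span_minimal subspace_coord_space) auto
      then show ?thesis using wX[OF that] by blast
    qed
    have "x = coord_proj f l x" using x by (simp add: coord_proj_on_coord_space)
    also have "\<dots> = (\<Sum>X\<in>D. if X \<in> E then w X else 0)"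
      unfolding x_sum coord_proj_sum
      by (intro sum.cong) (simp_all add: coord_proj_on_coord_space[OF w_hom] E_iff)
    also have "\<dots> = (\<Sum>X\<in>E. w X)"
      using E fin by (simp add: sum.If_cases Int_absorb1)
    also have "\<dots> \<in> vec.span (v ` E)"
    proof (rule vec.span_sum)
      fix X assume "X \<in> E"
      then show "w X \<in> vec.span (v ` E)"
        using wX[of X] E vec.span_mono[of "{v X}" "v ` E"] by blast
    qed
    finally show "x \<in> vec.span (v ` E)" .
  qed
  have "v ` E \<subseteq> ?C l" using v E_iff E by fastforce
  then have "vec.dim (?C l) = card (v ` E)"
    using span indep by (intro vec.dim_unique) auto
  then show ?thesis
    using card_image[OF inj_on_subset[OF inj E(2)]] by (simp add: E_def)
qed

text \<open>
  The coordinate lines form a decomposition. Grading the index set by these lines themselves makes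
  this an instance of the decomposition into homogeneous components.
\<close>

lemma exists_irreducible_decomposition:
  assumes \<zeta>: "primitive_root_of_unity n \<zeta>" and n: "n \<ge> 1"
  shows "\<exists>D. irreducible_decomposition (cyc_group \<zeta>) diag_action
    (UNIV :: (complex^('k::finite \<Rightarrow> 2)) set) D"
proof -
  let ?L = "\<lambda>s. vec.span {axis s 1} :: (complex^('k \<Rightarrow> 2)) set"
  have inj: "inj ?L"
  proof (rule injI)
    fix s t assume "?L s = ?L t"
    then have "axis s 1 \<in> ?L t" using vec.span_base[of "axis s 1" "{axis s 1}"] by auto
    then obtain c where "axis s 1 = c *s (axis t 1 :: complex^('k \<Rightarrow> 2))"
      unfolding vec.span_singleton by blast
    then have "(axis s 1 :: complex^('k \<Rightarrow> 2)) $ s = c * axis t 1 $ s" by simp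
    then show "s = t"
      by (simp add: axis_def split: if_splits)
  qed
  have "{t. ?L t = ?L s} = {s}" for s
    by (simp add: inj_eq[OF inj])
  then have L: "coord_space ?L (?L s) = ?L s" for s
    by (simp add: span_axis_eq_coord_space[symmetric])
  have "internal_direct_sum (range ?L) (coord_space ?L) UNIV"
    by (rule internal_direct_sum_coord_space) auto
  moreover have "(\<Pi>\<^sub>E X\<in>range ?L. coord_space ?L X) = (\<Pi>\<^sub>E X\<in>range ?L. X)"
    by (rule PiE_cong) (auto simp: L)
  ultimately have "internal_direct_sum (range ?L) (\<lambda>U. U) UNIV"
    by (simp add: internal_direct_sum_def)
  moreover have "irreducible_module (diag_action ` cyc_group \<zeta>) (?L s)" for s
  proof (rule irreducible_line[OF \<zeta> n])
    show "axis s 1 \<in> (coord_space (weight n) (weight n s) :: (complex^('k \<Rightarrow> 2)) set)"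
      by (auto simp: coord_space_def axis_def)
    show "axis s 1 \<noteq> (0 :: complex^('k \<Rightarrow> 2))"
      by (simp add: axis_eq_0_iff)
  qed
  ultimately have "irreducible_decomposition (cyc_group \<zeta>) diag_action UNIV (range ?L)"
    unfolding irreducible_decomposition_def by (intro conjI ballI) (auto elim!: rangeE)
  then show ?thesis ..
qed

lemma multiplicity_char:
  assumes \<zeta>: "primitive_root_of_unity n \<zeta>" and n: "n \<ge> 1" and "l < n"
  shows "has_multiplicity (cyc_group \<zeta>) diag_action (UNIV :: (complex^('k::finite \<Rightarrow> 2)) set)
    (char_action l) UNIV (vec.dim (coord_space (weight n) l :: (complex^('k \<Rightarrow> 2)) set))"
  unfolding has_multiplicity_def
proof (intro conjI allI impI exists_irreducible_decomposition[OF \<zeta> n])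
  fix D assume D: "irreducible_decomposition (cyc_group \<zeta>) diag_action
    (UNIV :: (complex^('k \<Rightarrow> 2)) set) D"
  have lines: "\<exists>v j. v \<noteq> 0 \<and> v \<in> coord_space (weight n) j \<and> X = vec.span {v}" if "X \<in> D" for X
  proof -
    have "irreducible_module (diag_action ` cyc_group \<zeta>) X"
      using D that by (simp add: irreducible_decomposition_def)
    from irreducible_submodule_is_line[OF \<zeta> n this] show ?thesis by blast
  qed
  have "module_iso (cyc_group \<zeta>) diag_action X (char_action l) UNIV \<longleftrightarrow> X \<subseteq> coord_space (weight n) l"
    if "X \<in> D" for X
  proof -
    obtain v j where v: "v \<noteq> 0" "v \<in> coord_space (weight n) j" "X = vec.span {v}"
      using lines[OF \<open>X \<in> D\<close>] by blast
    show ?thesis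
      unfolding v(3) by (rule module_iso_line_iff[OF \<zeta> n \<open>l < n\<close> v(2,1)])
  qed
  then have "{X \<in> D. module_iso (cyc_group \<zeta>) diag_action X (char_action l) UNIV}
      = {X \<in> D. X \<subseteq> coord_space (weight n) l}"
    by blast
  then show "card {X \<in> D. module_iso (cyc_group \<zeta>) diag_action X (char_action l) UNIV}
      = vec.dim (coord_space (weight n) l :: (complex^('k \<Rightarrow> 2)) set)"
    using D lines card_lines_in_coord_space[of D "weight n" l]
    by (simp add: irreducible_decomposition_def)
qed

section \<open>Coefficients modulo \<open>z\<^sup>m = 1\<close>\<close>

text \<open>
  Modulo \<open>z\<^sup>m - 1\<close> a power \<open>z\<^sup>b\<close> is congruent to \<open>z\<close> to the power \<open>b mod m\<close>, which is already
  reduced.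
\<close>

lemma monom_mod_cyclic:
  assumes "m \<ge> 1"
  shows "monom c b mod (monom 1 m - 1) = monom (c :: complex) (b mod m)"
proof -
  let ?q = "monom 1 m - 1 :: complex poly"
  have deg: "degree ?q = m"
    using assms degree_add_eq_left[of "- 1" "monom 1 m :: complex poly"]
    by (simp add: degree_monom_eq)
  have "monom c b mod ?q = monom c (b mod m) mod ?q"
  proof -
    have "?q dvd monom 1 m ^ (b div m) - 1"
      unfolding power_diff_1_eq by (rule dvd_triv_left)
    moreover have "monom c b - monom c (b mod m)
        = monom c (b mod m) * (monom 1 m ^ (b div m) - 1 :: complex poly)"
      by (simp add: right_diff_distrib monom_power mult_monom)
    ultimately have "?q dvd monom c b - monom c (b mod m)" by simp
    then show ?thesis by (simp add: mod_eq_dvd_iff)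
  qed
  also have "\<dots> = monom c (b mod m)"
    using assms deg by (intro mod_poly_less) (auto intro!: le_less_trans[OF degree_monom_le])
  finally show ?thesis .
qed

lemma cyclic_coeff_eq_sum:
  assumes "m \<ge> 1" and "degree p \<le> k"
  shows "cyclic_coeff m p a = (\<Sum>b | b \<le> k \<and> [b = a] (mod m). poly.coeff p b)"
proof -
  have mod_sum: "sum g A mod q = (\<Sum>b\<in>A. g b mod q)"
    for g :: "nat \<Rightarrow> complex poly" and A q
    by (induction A rule: infinite_finite_induct) (simp_all add: poly_mod_add_left)
  have "p mod (monom 1 m - 1) = (\<Sum>b\<le>k. monom (poly.coeff p b) (b mod m))"
    by (subst poly_as_sum_of_monoms'[OF assms(2), symmetric])
      (simp add: mod_sum monom_mod_cyclic[OF assms(1)])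
  then have "cyclic_coeff m p a = (\<Sum>b\<le>k. if b mod m = a mod m then poly.coeff p b else 0)"
    by (simp add: cyclic_coeff_def coeff_sum)
  also have "\<dots> = (\<Sum>b | b \<le> k \<and> [b = a] (mod m). poly.coeff p b)"
    by (subst sum.inter_filter[symmetric]) (simp_all add: cong_def)
  finally show ?thesis .
qed

lemma cyclic_coeff_binomial:
  assumes "m \<ge> 1"
  shows "cyclic_coeff m ([:1, 1:] ^ k) a = of_nat (\<Sum>b | b \<le> k \<and> [b = a] (mod m). k choose b)"
proof -
  have "degree ([:1, 1:] ^ k :: complex poly) \<le> k"
    by (simp add: degree_power_eq)
  then have "cyclic_coeff m ([:1, 1:] ^ k) a
      = (\<Sum>b | b \<le> k \<and> [b = a] (mod m). poly.coeff ([:1, 1:] ^ k) b)"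
    by (rule cyclic_coeff_eq_sum[OF assms])
  also have "\<dots> = of_nat (\<Sum>b | b \<le> k \<and> [b = a] (mod m). k choose b)"
    by (simp add: coeff_linear_poly_power)
  finally show ?thesis .
qed

section \<open>Walks\<close>

text \<open>Splitting off the first step gives the recursion of Pascal's triangle.\<close>

lemma card_sign_lists:
  "card {s :: int list. length s = k \<and> set s \<subseteq> {-1, 1} \<and> count_list s (-1) = b} = k choose b"
proof (induction k arbitrary: b)
  case 0
  have "{s :: int list. length s = 0 \<and> set s \<subseteq> {-1, 1} \<and> count_list s (-1) = b}
      = (if b = 0 then {[]} else {})" by auto
  then show ?case by simp
next
  case (Suc k)
  define W where "W k b = {s :: int list. length s = k \<and> set s \<subseteq> {-1, 1} \<and> count_list s (-1) = b}" for k b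
  have fin: "finite (W k b)" for k b
    by (rule finite_subset[OF _ finite_lists_length_eq[of "{-1, 1 :: int}" k]]) (auto simp: W_def)
  have IH: "card (W k b) = k choose b" for b using Suc.IH by (simp add: W_def)
  show ?case
  proof (cases b)
    case 0
    have "W (Suc k) 0 = Cons 1 ` W k 0"
      by (auto simp: W_def length_Suc_conv image_iff split: if_splits)
    then show ?thesis
      using IH by (simp add: 0 W_def[symmetric] card_image)
  next
    case (Suc c)
    have step: "W (Suc k) (Suc c) = Cons 1 ` W k (Suc c) \<union> Cons (-1) ` W k c"
      by (auto simp: W_def length_Suc_conv image_iff split: if_splits)
    have "card (W (Suc k) (Suc c)) = card (W k (Suc c)) + card (W k c)"
      using fin by (subst step, subst card_Un_disjoint) (auto simp: card_image)
    then show ?thesis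
      using IH by (simp add: Suc W_def[symmetric])
  qed
qed

lemma sum_list_signs:
  "set s \<subseteq> {-1, 1} \<Longrightarrow> sum_list s = int (length s) - 2 * int (count_list s (-1))"
  by (induction s) auto

lemma foldl_mod_sum_list:
  "foldl (\<lambda>v d. (v + d) mod n) (i mod n) s = (i + sum_list s) mod (n :: int)"
proof (induction s arbitrary: i)
  case (Cons d s)
  then show ?case using Cons.IH[of "i + d"] by (simp add: mod_simps add.assoc)
qed simp

text \<open>
  Starting from \<open>0\<close>, a walk with \<open>b\<close> steps \<open>-1\<close> ends at the residue of \<open>k - 2 b\<close>, just as a basis
  tensor with \<open>b\<close> factors \<open>vbasis (-1)\<close> has this residue as its weight.
\<close>

lemma card_walks:
  assumes "n \<ge> 1" and "l \<in> Lambda n k"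
  shows "card (walks n 0 l k)
    = (\<Sum>b | b \<le> k \<and> [b = a_min n k l] (mod n_tilde n). k choose b)"
proof -
  define W where "W b = {s :: int list. length s = k \<and> set s \<subseteq> {-1, 1} \<and> count_list s (-1) = b}" for b
  have "l < n" using assms(2) by (simp add: Lambda_def)
  have ends: "foldl (\<lambda>v d. (v + d) mod int n) 0 s = int l
      \<longleftrightarrow> [count_list s (-1) = a_min n k l] (mod n_tilde n)"
    if "length s = k" "set s \<subseteq> {-1, 1}" for s
  proof -
    have "foldl (\<lambda>v d. (v + d) mod int n) 0 s = (int k - 2 * int (count_list s (-1))) mod int n"
      using foldl_mod_sum_list[of "int n" 0 s] sum_list_signs[OF that(2)] that(1) by simp
    also have "\<dots> = int l \<longleftrightarrow> [int k - 2 * int (count_list s (-1)) = int l] (mod int n)"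
      using \<open>l < n\<close> by (simp only: cong_def) simp
    finally show ?thesis by (simp only: cong_a_min_iff[OF assms])
  qed
  have "walks n 0 l k = (\<Union>b\<in>{b. b \<le> k \<and> [b = a_min n k l] (mod n_tilde n)}. W b)"
    using ends count_le_length by (auto simp: walks_def W_def)
  moreover have "finite (W b)" for b
    by (rule finite_subset[OF _ finite_lists_length_eq[of "{-1, 1 :: int}" k]]) (auto simp: W_def)
  moreover have "W b \<inter> W c = {}" if "b \<noteq> c" for b c using that by (auto simp: W_def)
  ultimately have "card (walks n 0 l k)
      = (\<Sum>b | b \<le> k \<and> [b = a_min n k l] (mod n_tilde n). card (W b))"
    by (simp add: card_UN_disjoint)
  then show ?thesis by (simp add: W_def card_sign_lists)
qed

section \<open>Structure of the tensor power\<close>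

lemma n_tilde_pos: "n \<ge> 1 \<Longrightarrow> n_tilde n \<ge> 1"
  by (cases "n = 1") (auto simp: n_tilde_def elim!: evenE)

lemma card_eq_sum_binomial:
  assumes "\<And>b. card {s :: 's. c s = b} = k choose b" and "\<And>s. c s \<le> k"
    and fin: "finite (UNIV :: 's set)"
  shows "card {s :: 's. P (c s)} = (\<Sum>b | b \<le> k \<and> P b. k choose b)"
proof -
  have "card {s :: 's. P (c s)} = card (\<Union>b\<in>{b. b \<le> k \<and> P b}. {s. c s = b})"
    using assms(2) by (intro arg_cong[where f = card]) auto
  also have "\<dots> = (\<Sum>b | b \<le> k \<and> P b. card {s. c s = b})"
    using fin by (subst card_UN_disjoint) (auto intro: finite_subset)
  finally show ?thesis using assms(1) by simp
qed

lemma dim_coord_space_weight: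
  assumes "n \<ge> 1" and "l \<in> Lambda n CARD('k::finite)"
  shows "vec.dim (coord_space (weight n) l :: (complex^('k \<Rightarrow> 2)) set)
    = (\<Sum>b | b \<le> CARD('k) \<and> [b = a_min n CARD('k) l] (mod n_tilde n). CARD('k) choose b)"
  unfolding dim_coord_space weight_eq_iff_ones[OF assms]
  by (rule card_eq_sum_binomial[OF card_ones ones_le]) simp

lemma internal_direct_sum_cong:
  assumes "\<And>i. i \<in> I \<Longrightarrow> M i = N i"
  shows "internal_direct_sum I M W \<longleftrightarrow> internal_direct_sum I N W"
  using assms PiE_cong[of I M N] by (simp add: internal_direct_sum_def)

lemma linear_iso_to_direct_sum_cong:
  assumes "\<And>i. i \<in> I \<Longrightarrow> M i = N i"
  shows "linear_iso_to_direct_sum \<Phi> W I M \<longleftrightarrow> linear_iso_to_direct_sum \<Phi> W I N"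
  using assms PiE_cong[of I M N] by (simp add: linear_iso_to_direct_sum_def)

theorem theorem2p17:
  fixes n l :: nat and \<zeta> :: complex
  assumes "n \<ge> 1"
    and "primitive_root_of_unity n \<zeta>"
    and "l \<in> Lambda n CARD('k::finite)"
  shows
    "irreducible_module (End_group (cyc_group \<zeta>) diag_action)
       (Zmod n l :: (complex^('k \<Rightarrow> 2)) set)

   \<and> vec.dim (Zmod n l :: (complex^('k \<Rightarrow> 2)) set)
       = (\<Sum>b | b \<le> CARD('k) \<and> [b = a_min n CARD('k) l] (mod n_tilde n). CARD('k) choose b)
   \<and> of_nat (\<Sum>b | b \<le> CARD('k) \<and> [b = a_min n CARD('k) l] (mod n_tilde n). CARD('k) choose b)
       = cyclic_coeff (n_tilde n) ([:1, 1:] ^ CARD('k)) (a_min n CARD('k) l)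

   \<and> (\<exists>\<Phi> :: complex^('k \<Rightarrow> 2) \<Rightarrow> nat \<Rightarrow> complex^(1 \<times> ('k \<Rightarrow> 2)).
         linear_iso_to_direct_sum \<Phi> UNIV (Lambda n CARD('k)) (\<lambda>j. tensor_space UNIV (Zmod n j))
       \<and> (\<forall>h\<in>cyc_group \<zeta>. \<forall>x. \<forall>j\<in>Lambda n CARD('k).
            \<Phi> (diag_action h x) j = tensor_map (char_action j h) id (\<Phi> x j))
       \<and> (\<forall>T\<in>End_group (cyc_group \<zeta>) diag_action. \<forall>x. \<forall>j\<in>Lambda n CARD('k).
            \<Phi> (T x) j = tensor_map id T (\<Phi> x j)))
   \<and> internal_direct_sum (Lambda n CARD('k)) (Zmod n) (UNIV :: (complex^('k \<Rightarrow> 2)) set)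
   \<and> (\<forall>j\<in>Lambda n CARD('k).
        is_submodule (diag_action ` cyc_group \<zeta> \<union> End_group (cyc_group \<zeta>) diag_action)
          (Zmod n j :: (complex^('k \<Rightarrow> 2)) set))

   \<and> has_multiplicity (cyc_group \<zeta>) diag_action (UNIV :: (complex^('k \<Rightarrow> 2)) set)
       (char_action l) UNIV
       (\<Sum>b | b \<le> CARD('k) \<and> [b = a_min n CARD('k) l] (mod n_tilde n). CARD('k) choose b)

   \<and> of_nat (card (walks n 0 l CARD('k)))
       = cyclic_coeff (n_tilde n) ([:1, 1:] ^ CARD('k)) (a_min n CARD('k) l)
   \<and> card (walks n 0 l CARD('k)) = vec.dim (Zmod n l :: (complex^('k \<Rightarrow> 2)) set)"
proof -
  let ?k = "CARD('k)" and ?C = "coord_space (weight n :: ('k \<Rightarrow> 2) \<Rightarrow> nat)"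
  let ?Z = "Zmod n :: nat \<Rightarrow> (complex^('k \<Rightarrow> 2)) set"
  let ?S = "\<Sum>b | b \<le> ?k \<and> [b = a_min n ?k l] (mod n_tilde n). ?k choose b"
  note n = assms(1) and \<zeta> = assms(2) and l = assms(3)
  have Z: "?Z j = ?C j" if "j \<in> Lambda n ?k" for j
    by (rule Zmod_eq_coord_space[OF n that])
  have range: "range (weight n :: ('k \<Rightarrow> 2) \<Rightarrow> nat) \<subseteq> Lambda n ?k"
    using weight_in_Lambda[OF n] by blast
  have "l < n" using l by (simp add: Lambda_def)
  have dim: "vec.dim (?Z l) = ?S"
    unfolding Z[OF l] by (rule dim_coord_space_weight[OF n l])
  have coeff: "of_nat ?S = cyclic_coeff (n_tilde n) ([:1, 1:] ^ ?k) (a_min n ?k l)"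
    by (rule cyclic_coeff_binomial[OF n_tilde_pos[OF n], symmetric])
  have walks: "card (walks n 0 l ?k) = ?S"
    by (rule card_walks[OF n l])
  obtain s :: "'k \<Rightarrow> 2" where "weight n s = l" using ex_weight[OF n l] by blast
  from irreducible_coord_space[OF \<zeta> n this]
  have irred: "irreducible_module (End_group (cyc_group \<zeta>) diag_action) (?Z l)"
    unfolding Z[OF l] .
  have iso: "linear_iso_to_direct_sum \<Phi> UNIV (Lambda n ?k) (\<lambda>j. tensor_space (UNIV :: (complex^1) set) (?Z j))
      \<longleftrightarrow> linear_iso_to_direct_sum \<Phi> UNIV (Lambda n ?k) (\<lambda>j. tensor_space UNIV (?C j))"
    for \<Phi> :: "complex^('k \<Rightarrow> 2) \<Rightarrow> nat \<Rightarrow> complex^(1 \<times> ('k \<Rightarrow> 2))"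
    by (rule linear_iso_to_direct_sum_cong) (simp add: Z)
  note bimodule = bimodule_decomposition[OF \<zeta> n finite_Lambda range, folded iso]
  have direct: "internal_direct_sum (Lambda n ?k) ?Z UNIV"
    using internal_direct_sum_coord_space[OF finite_Lambda range]
      internal_direct_sum_cong[of "Lambda n ?k" ?Z ?C] Z by blast
  have submodule: "is_submodule (diag_action ` cyc_group \<zeta> \<union> End_group (cyc_group \<zeta>) diag_action) (?Z j)"
    if "j \<in> Lambda n ?k" for j
    unfolding is_submodule_def Z[OF that]
  proof (intro conjI ballI)
    fix T :: "complex^('k \<Rightarrow> 2) \<Rightarrow> complex^('k \<Rightarrow> 2)" and x
    assume T: "T \<in> diag_action ` cyc_group \<zeta> \<union> End_group (cyc_group \<zeta>) diag_action"
      and x: "x \<in> ?C j"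
    from T show "T x \<in> ?C j"
    proof
      assume "T \<in> diag_action ` cyc_group \<zeta>"
      then obtain m where "T = diag_action (cyc_gen (\<zeta> ^ m))"
        using cyc_group_powers[OF \<zeta> n] by auto
      then show ?thesis
        using x by (simp add: diag_action_on_coord_space[OF \<zeta> n x]
            vec.subspace_scale[OF subspace_coord_space])
    qed (rule End_group_preserves_coord_space[OF \<zeta> n _ x])
  qed (rule subspace_coord_space)
  have mult: "has_multiplicity (cyc_group \<zeta>) diag_action (UNIV :: (complex^('k \<Rightarrow> 2)) set)
      (char_action l) UNIV ?S"
    unfolding dim_coord_space_weight[OF n l, symmetric]
    by (rule multiplicity_char[OF \<zeta> n \<open>l < n\<close>])
  show ?thesis
    using irred dim coeff bimodule direct submodule mult walks by (intro conjI ballI) simp_all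
qed

end
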